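(* The assignment of the functions $\mathfrak{p}_{\mathscr{C}}$ is a strong parity on the category of $2$-colourable oriented virtual link diagrams. Explicitly: let $D$ be a $2$-colourable oriented virtual link diagram and let $\mathscr{C}$ be a $2$-colouring of $D$; then the functions $\mathfrak{p}_{\mathscr{C}}$ (from the set of classical crossings to $\mathbb{Z}_2$), where $2$-colourings are transported along virtual Reidemeister moves, satisfy parity axioms (0), (1), (2) and (3), and there is no Reidemeister III move in which all three of the crossings involved are odd.
   Context: A virtual link diagram is a generic immersion of finitely many circles in the plane whose double points are marked either as classical crossings (with over/under information) or virtual crossings. A virtual link is an equivalence class of such diagrams under the virtual Reidemeister moves (the classical Reidemeister moves I, II, III together with the usual moves involving virtual crossings). Classical crossings of an oriented diagram have a sign in the usual way. Shadow: $S(D)$ is obtained from $D$ by forgetting the over/under decoration at classical crossings, which become flat crossings. The arcs of $S(D)$ run between flat crossings (passing straight through virtual crossings); a component without classical crossings is a single arc. A $2$-colouring $\mathscr{C}$ of $D$ is a colouring of the arcs of $S(D)$, each arc exactly one of red and green, such that at every flat crossing the four incident arc-ends are, in cyclic order and up to rotation, red, red, green, green; equivalently, on each of the two strands through a flat crossing the colour changes when passing straight through the crossing. $D$ is $2$-colourable if it has a $2$-colouring. $2$-colour parity: for an oriented diagram $D$ with $2$-colouring $\mathscr{C}$ and a classical crossing $c$, set $\mathfrak{p}_{\mathscr{C}}(c)=0$ ($c$ is even) if the two arcs oriented into $c$ have different colours, and $\mathfrak{p}_{\mathscr{C}}(c)=1$ ($c$ is odd) if the two arcs oriented into $c$ have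 the same colour. Transport: if $D'$ is obtained from $D$ by a single virtual Reidemeister move, a $2$-colouring $\mathscr{C}$ of $D$ induces the $2$-colouring $\mathscr{C}'$ of $D'$ that agrees with $\mathscr{C}$ outside the disc in which the move takes place, and $D'$ is given the function $\mathfrak{p}_{\mathscr{C}'}$. Parity axioms, for an assignment of functions $f_D$ from classical crossings of $D$ to $\mathbb{Z}_2$ (crossings mapped to $0$ are even, to $1$ odd): (0) If $D$ and $D'$ are related by a single virtual Reidemeister move, the parities of the crossings not involved in the move do not change. (1) If $D$ and $D'$ are related by a Reidemeister I move eliminating a crossing, the parity of that crossing is even. (2) If $D$ and $D'$ are related by a Reidemeister II move eliminating crossings $c_1,c_2$, then $f_D(c_1)=f_D(c_2)$. (3) If $D$ and $D'$ are related by a Reidemeister III move involving $c_1,c_2,c_3$, then exactly one of the following holds: all three are odd, all three are even, or exactly two are odd; further, the parities of $c_1,c_2,c_3$ are unchanged in $D'$. A parity is strong if there are no Reidemeister III moves in which all of the crossings involved are odd. *)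

theory Defs
  imports "HOL-Analysis.Analysis" "HOL-Library.Z2"
begin

section \<open>Oriented virtual link diagrams\<close>

text \<open>
  The immersed circles are parametrised by numbered copies of the unit circle in the complex plane:
  the pair \<open>(i, z)\<close> is the point \<open>z\<close> of the \<open>i\<close>-th circle, and every circle is oriented
  counterclockwise.  Crossings are points of the plane.  The field \<open>classical\<close> is the set of
  classical crossings, all other double points being virtual; \<open>over p\<close> is the preimage of the
  classical crossing \<open>p\<close> that lies on the overcrossing strand.
\<close>

type_synonym circle_point = "nat \<times> complex"

record vdiagram =
  ncomp :: nat
  curve :: "circle_point \<Rightarrow> complex"
  classical :: "complex set"
  over :: "complex \<Rightarrow> circle_point"

definition circles :: "vdiagram \<Rightarrow> circle_point set" where
  "circles D = {..<ncomp D} \<times> sphere 0 1"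

definition rot :: "circle_point \<Rightarrow> real \<Rightarrow> circle_point" where
  "rot x e = (fst x, snd x * cis e)"

definition preim :: "vdiagram \<Rightarrow> complex \<Rightarrow> circle_point set" where
  "preim D p = {x \<in> circles D. curve D x = p}"

definition crossings :: "vdiagram \<Rightarrow> complex set" where
  "crossings D = {p. \<exists>x \<in> preim D p. \<exists>y \<in> preim D p. x \<noteq> y}"

definition velocity :: "vdiagram \<Rightarrow> circle_point \<Rightarrow> complex" where
  "velocity D x = vector_derivative (\<lambda>t. curve D (rot x t)) (at 0)"

definition generic_immersion :: "vdiagram \<Rightarrow> bool" where
  "generic_immersion D \<longleftrightarrow>
     (\<forall>i < ncomp D. (\<lambda>t. curve D (i, cis t)) C1_differentiable_on UNIV) \<and>
     (\<forall>x \<in> circles D. velocity D x \<noteq> 0) \<and>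
     finite (crossings D) \<and>
     (\<forall>p \<in> crossings D. card (preim D p) = 2 \<and>
        (\<forall>x \<in> preim D p. \<forall>y \<in> preim D p.
           x \<noteq> y \<longrightarrow> \<not> collinear {0, velocity D x, velocity D y}))"

definition virtual_link_diagram :: "vdiagram \<Rightarrow> bool" where
  "virtual_link_diagram D \<longleftrightarrow>
     generic_immersion D \<and> classical D \<subseteq> crossings D \<and>
     (\<forall>p \<in> classical D. over D p \<in> preim D p)"


section \<open>The shadow, 2-colourings and the 2-colour parity\<close>

text \<open>
  An arc of the shadow is a connected component of the source circles cut open at the preimages of
  the classical crossings.  A circle without such preimages is a single arc.
\<close>

definition flat_points :: "vdiagram \<Rightarrow> circle_point set" where
  "flat_points D = {x \<in> circles D. curve D x \<in> classical D}"

definition arcs :: "vdiagram \<Rightarrow> circle_point set set" where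
  "arcs D = components (circles D - flat_points D)"

definition arc_at :: "vdiagram \<Rightarrow> circle_point \<Rightarrow> circle_point set" where
  "arc_at D x = connected_component_set (circles D - flat_points D) x"

text \<open>For \<open>x\<close> in \<open>flat_points D\<close>: the arc that ends at \<open>x\<close>, and the arc that starts at \<open>x\<close>.\<close>

definition arc_in :: "vdiagram \<Rightarrow> circle_point \<Rightarrow> circle_point set" where
  "arc_in D x = (THE a. a \<in> arcs D \<and> (\<forall>\<^sub>F e in at_right 0. rot x (- e) \<in> a))"

definition arc_out :: "vdiagram \<Rightarrow> circle_point \<Rightarrow> circle_point set" where
  "arc_out D x = (THE a. a \<in> arcs D \<and> (\<forall>\<^sub>F e in at_right 0. rot x e \<in> a))"

datatype colour = Red | Green

type_synonym colouring = "circle_point set \<Rightarrow> colour"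

definition two_colouring :: "vdiagram \<Rightarrow> colouring \<Rightarrow> bool" where
  "two_colouring D C \<longleftrightarrow>
     C \<in> arcs D \<rightarrow>\<^sub>E UNIV \<and>
     (\<forall>p \<in> classical D. \<forall>x \<in> preim D p. C (arc_in D x) \<noteq> C (arc_out D x))"

text \<open>
  The two strands through a crossing are transverse, so the four arc-ends alternate between them:
  in cyclic order (in one of the two directions) they are the incoming end of the first strand, the
  incoming end of the second, the outgoing end of the first, the outgoing end of the second.  The
  colour condition on each strand therefore says that the ends are red, red, green, green up to
  rotation, a pattern which does not depend on the direction:
\<close>

lemma red_red_green_green_iff:
  "(\<exists>k. rotate k [in1, in2, out1, out2] = [Red, Red, Green, Green]) \<longleftrightarrow>
     in1 \<noteq> out1 \<and> in2 \<noteq> out2"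
proof
  assume "\<exists>k. rotate k [in1, in2, out1, out2] = [Red, Red, Green, Green]"
  then obtain k where "rotate k [in1, in2, out1, out2] = [Red, Red, Green, Green]" ..
  then have *: "rotate (k mod 4) [in1, in2, out1, out2] = [Red, Red, Green, Green]"
    using rotate_conv_mod[of k "[in1, in2, out1, out2]"] by simp
  have "k mod 4 < 4" by simp
  then have "k mod 4 \<in> {0, Suc 0, Suc (Suc 0), Suc (Suc (Suc 0))}" by force
  with * show "in1 \<noteq> out1 \<and> in2 \<noteq> out2" by auto
next
  assume "in1 \<noteq> out1 \<and> in2 \<noteq> out2"
  then have "rotate 0 [in1, in2, out1, out2] = [Red, Red, Green, Green] \<or>
      rotate (Suc 0) [in1, in2, out1, out2] = [Red, Red, Green, Green] \<or>
      rotate (Suc (Suc 0)) [in1, in2, out1, out2] = [Red, Red, Green, Green] \<or>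
      rotate (Suc (Suc (Suc 0))) [in1, in2, out1, out2] = [Red, Red, Green, Green]"
    by (cases in1; cases in2; cases out1; cases out2) simp_all
  then show "\<exists>k. rotate k [in1, in2, out1, out2] = [Red, Red, Green, Green]" by blast
qed

definition colour_parity :: "vdiagram \<Rightarrow> colouring \<Rightarrow> complex \<Rightarrow> bit" where
  "colour_parity D C c =
     (if \<exists>x \<in> preim D c. \<exists>y \<in> preim D c. C (arc_in D x) \<noteq> C (arc_in D y) then 0 else 1)"


section \<open>Virtual Reidemeister moves\<close>

text \<open>
  \<open>(i, a, b)\<close> is the strand of the \<open>i\<close>-th circle from \<open>cis a\<close> to \<open>cis b\<close>.
\<close>

type_synonym strand = "nat \<times> real \<times> real"

definition strand_arc :: "strand \<Rightarrow> circle_point set" where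
  "strand_arc = (\<lambda>(i, a, b). (\<lambda>t. (i, cis t)) ` {a..b})"

definition strand_interior :: "strand \<Rightarrow> circle_point set" where
  "strand_interior = (\<lambda>(i, a, b). (\<lambda>t. (i, cis t)) ` {a<..<b})"

text \<open>
  The part of \<open>D\<close> in the disc \<open>B\<close> consists of the strands \<open>S\<close>, each of which runs through
  the interior of \<open>B\<close> from one boundary point to another.
\<close>

definition meets_disc_in :: "complex set \<Rightarrow> strand list \<Rightarrow> vdiagram \<Rightarrow> bool" where
  "meets_disc_in B S D \<longleftrightarrow>
     (\<forall>(i, a, b) \<in> set S. i < ncomp D \<and> a < b \<and> b < a + 2 * pi) \<and>
     disjoint_family_on (\<lambda>j. strand_arc (S ! j)) {..<length S} \<and>
     {x \<in> circles D. curve D x \<in> B} = (\<Union>s \<in> set S. strand_arc s) \<and>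
     {x \<in> circles D. curve D x \<in> interior B} = (\<Union>s \<in> set S. strand_interior s) \<and>
     crossings D \<inter> frontier B = {}"

definition local_change :: "complex set \<Rightarrow> strand list \<Rightarrow> vdiagram \<Rightarrow> vdiagram \<Rightarrow> bool" where
  "local_change B S D D' \<longleftrightarrow>
     virtual_link_diagram D \<and> virtual_link_diagram D' \<and>
     B homeomorphic (cball 0 1 :: complex set) \<and>
     meets_disc_in B S D \<and> meets_disc_in B S D' \<and>
     ncomp D = ncomp D' \<and>
     (\<forall>x \<in> circles D - (\<Union>s \<in> set S. strand_interior s). curve D x = curve D' x) \<and>
     classical D - B = classical D' - B \<and>
     (\<forall>p \<in> classical D - B. over D p = over D' p)"

text \<open>\<open>p\<close> is a crossing of the strand \<open>s\<close> with the strand \<open>s'\<close> (a self-crossing if \<open>s = s'\<close>).\<close>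

definition crosses :: "vdiagram \<Rightarrow> strand \<Rightarrow> strand \<Rightarrow> complex \<Rightarrow> bool" where
  "crosses D s s' p \<longleftrightarrow>
     (\<exists>x \<in> strand_arc s. \<exists>y \<in> strand_arc s'. x \<noteq> y \<and> preim D p = {x, y})"

definition before :: "vdiagram \<Rightarrow> strand \<Rightarrow> complex \<Rightarrow> complex \<Rightarrow> bool" where
  "before D = (\<lambda>(i, a, b) p q.
     \<exists>t \<in> {a..b}. \<exists>u \<in> {a..b}. t < u \<and> curve D (i, cis t) = p \<and> curve D (i, cis u) = q)"

text \<open>
  The moves with one and with two strands are stated in the direction that eliminates crossings.
  The topology of the disc determines the picture: a strand with a single transverse
  self-crossing is a kink, and two embedded strands that cross exactly twice bound a bigon.
\<close>

definition kink :: "complex set \<Rightarrow> vdiagram \<Rightarrow> vdiagram \<Rightarrow> complex \<Rightarrow> bool" where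
  "kink B D D' c \<longleftrightarrow>
     (\<exists>s. local_change B [s] D D' \<and>
        crossings D \<inter> B = {c} \<and> crosses D s s c \<and> crossings D' \<inter> B = {})"

definition bigon ::
    "complex set \<Rightarrow> vdiagram \<Rightarrow> vdiagram \<Rightarrow> strand \<Rightarrow> strand \<Rightarrow> complex \<Rightarrow> complex \<Rightarrow> bool" where
  "bigon B D D' s s' c1 c2 \<longleftrightarrow>
     local_change B [s, s'] D D' \<and>
     c1 \<noteq> c2 \<and> crossings D \<inter> B = {c1, c2} \<and>
     crosses D s s' c1 \<and> crosses D s s' c2 \<and> crossings D' \<inter> B = {}"

definition triangle ::
    "complex set \<Rightarrow> vdiagram \<Rightarrow> strand \<Rightarrow> strand \<Rightarrow> strand \<Rightarrow> complex \<Rightarrow> complex \<Rightarrow> complex \<Rightarrow> bool" where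
  "triangle B D s1 s2 s3 c12 c13 c23 \<longleftrightarrow>
     crossings D \<inter> B = {c12, c13, c23} \<and>
     crosses D s1 s2 c12 \<and> crosses D s1 s3 c13 \<and> crosses D s2 s3 c23"

text \<open>
  In a move of the third type any two of the three strands cross exactly once on either side of the
  move, and the order of the two crossings on each strand is reversed.  The crossing \<open>d12\<close> of
  \<open>D'\<close> corresponds to the crossing \<open>c12\<close> of \<open>D\<close>, and likewise for the other two.
\<close>

definition triangle_move ::
    "complex set \<Rightarrow> vdiagram \<Rightarrow> vdiagram \<Rightarrow> strand \<Rightarrow> strand \<Rightarrow> strand \<Rightarrow>
     complex \<Rightarrow> complex \<Rightarrow> complex \<Rightarrow> complex \<Rightarrow> complex \<Rightarrow> complex \<Rightarrow> bool" where
  "triangle_move B D D' s1 s2 s3 c12 c13 c23 d12 d13 d23 \<longleftrightarrow>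
     local_change B [s1, s2, s3] D D' \<and>
     triangle B D s1 s2 s3 c12 c13 c23 \<and> triangle B D' s1 s2 s3 d12 d13 d23 \<and>
     (before D s1 c12 c13 \<longleftrightarrow> before D' s1 d13 d12) \<and>
     (before D s2 c12 c23 \<longleftrightarrow> before D' s2 d23 d12) \<and>
     (before D s3 c13 c23 \<longleftrightarrow> before D' s3 d23 d13)"

definition reidemeister1 :: "complex set \<Rightarrow> vdiagram \<Rightarrow> vdiagram \<Rightarrow> complex \<Rightarrow> bool" where
  "reidemeister1 B D D' c \<longleftrightarrow> kink B D D' c \<and> c \<in> classical D"

definition reidemeister2 :: "complex set \<Rightarrow> vdiagram \<Rightarrow> vdiagram \<Rightarrow> complex \<Rightarrow> complex \<Rightarrow> bool" where
  "reidemeister2 B D D' c1 c2 \<longleftrightarrow>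
     (\<exists>s s'. bigon B D D' s s' c1 c2 \<and> c1 \<in> classical D \<and> c2 \<in> classical D \<and>
        (over D c1 \<in> strand_arc s \<longleftrightarrow> over D c2 \<in> strand_arc s))"

definition reidemeister3 ::
    "complex set \<Rightarrow> vdiagram \<Rightarrow> vdiagram \<Rightarrow>
     complex \<Rightarrow> complex \<Rightarrow> complex \<Rightarrow> complex \<Rightarrow> complex \<Rightarrow> complex \<Rightarrow> bool" where
  "reidemeister3 B D D' c1 c2 c3 d1 d2 d3 \<longleftrightarrow>
     (\<exists>top mid bottom.
        triangle_move B D D' top mid bottom c1 c2 c3 d1 d2 d3 \<and>
        {c1, c2, c3} \<subseteq> classical D \<and> {d1, d2, d3} \<subseteq> classical D' \<and>
        over D c1 \<in> strand_arc top \<and> over D c2 \<in> strand_arc top \<and> over D c3 \<in> strand_arc mid \<and>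
        over D' d1 \<in> strand_arc top \<and> over D' d2 \<in> strand_arc top \<and> over D' d3 \<in> strand_arc mid)"

definition virtual1 :: "complex set \<Rightarrow> vdiagram \<Rightarrow> vdiagram \<Rightarrow> bool" where
  "virtual1 B D D' \<longleftrightarrow> (\<exists>c. kink B D D' c \<and> c \<notin> classical D)"

definition virtual2 :: "complex set \<Rightarrow> vdiagram \<Rightarrow> vdiagram \<Rightarrow> bool" where
  "virtual2 B D D' \<longleftrightarrow>
     (\<exists>s s' c1 c2. bigon B D D' s s' c1 c2 \<and> c1 \<notin> classical D \<and> c2 \<notin> classical D)"

definition virtual3 :: "complex set \<Rightarrow> vdiagram \<Rightarrow> vdiagram \<Rightarrow> bool" where
  "virtual3 B D D' \<longleftrightarrow>
     (\<exists>s1 s2 s3 c1 c2 c3 d1 d2 d3.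
        triangle_move B D D' s1 s2 s3 c1 c2 c3 d1 d2 d3 \<and>
        {c1, c2, c3} \<inter> classical D = {} \<and> {d1, d2, d3} \<inter> classical D' = {})"

text \<open>
  The mixed move: a strand with two virtual crossings moves across the classical crossing \<open>c\<close>,
  which becomes the classical crossing \<open>d\<close>.
\<close>

definition mixed_move :: "complex set \<Rightarrow> vdiagram \<Rightarrow> vdiagram \<Rightarrow> complex \<Rightarrow> complex \<Rightarrow> bool" where
  "mixed_move B D D' c d \<longleftrightarrow>
     (\<exists>s1 s2 s3 v1 v2 w1 w2.
        triangle_move B D D' s1 s2 s3 c v1 v2 d w1 w2 \<and>
        {c, v1, v2} \<inter> classical D = {c} \<and> {d, w1, w2} \<inter> classical D' = {d} \<and>
        (over D c \<in> strand_arc s1 \<longleftrightarrow> over D' d \<in> strand_arc s1))"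

definition elementary_move :: "complex set \<Rightarrow> vdiagram \<Rightarrow> vdiagram \<Rightarrow> bool" where
  "elementary_move B D D' \<longleftrightarrow>
     (\<exists>c. reidemeister1 B D D' c) \<or>
     (\<exists>c1 c2. reidemeister2 B D D' c1 c2) \<or>
     (\<exists>c1 c2 c3 d1 d2 d3. reidemeister3 B D D' c1 c2 c3 d1 d2 d3) \<or>
     virtual1 B D D' \<or> virtual2 B D D' \<or> virtual3 B D D' \<or>
     (\<exists>c d. mixed_move B D D' c d)"

definition reidemeister_move :: "complex set \<Rightarrow> vdiagram \<Rightarrow> vdiagram \<Rightarrow> bool" where
  "reidemeister_move B D D' \<longleftrightarrow> elementary_move B D D' \<or> elementary_move B D' D"


section \<open>Transport of 2-colourings\<close>

definition agree_outside ::
    "complex set \<Rightarrow> vdiagram \<times> colouring \<Rightarrow> vdiagram \<times> colouring \<Rightarrow> bool" where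
  "agree_outside B = (\<lambda>(D, C) (D', C').
     \<forall>x \<in> circles D - flat_points D. curve D x \<notin> B \<longrightarrow> C (arc_at D x) = C' (arc_at D' x))"

definition coloured_move ::
    "complex set \<Rightarrow> vdiagram \<times> colouring \<Rightarrow> vdiagram \<times> colouring \<Rightarrow> bool" where
  "coloured_move B = (\<lambda>(D, C) (D', C').
     reidemeister_move B D D' \<and> two_colouring D C \<and> two_colouring D' C' \<and>
     agree_outside B (D, C) (D', C'))"


section \<open>Parities\<close>

text \<open>
  Parities are defined for diagrams equipped with an additional structure of type \<open>'c\<close>.  The
  relation \<open>M B X Y\<close> says that \<open>X\<close> and \<open>Y\<close> are related by a single virtual Reidemeister
  move in the disc \<open>B\<close> which transports the structure.  In the first axiom the classical crossing of
  the mixed move persists, although it lies in the disc, since no other axiom speaks about it.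
\<close>

definition persists ::
    "complex set \<Rightarrow> vdiagram \<Rightarrow> vdiagram \<Rightarrow> complex \<Rightarrow> complex \<Rightarrow> bool" where
  "persists B D D' c d \<longleftrightarrow> (c \<in> classical D - B \<and> d = c) \<or> mixed_move B D D' c d"

definition is_parity ::
    "(complex set \<Rightarrow> vdiagram \<times> 'c \<Rightarrow> vdiagram \<times> 'c \<Rightarrow> bool) \<Rightarrow>
     (vdiagram \<times> 'c \<Rightarrow> complex \<Rightarrow> bit) \<Rightarrow> bool" where
  "is_parity M f \<longleftrightarrow>
     (\<forall>B X Y c d. M B X Y \<and> persists B (fst X) (fst Y) c d \<longrightarrow> f X c = f Y d) \<and>
     (\<forall>B X Y c. M B X Y \<and> reidemeister1 B (fst X) (fst Y) c \<longrightarrow> f X c = 0) \<and>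
     (\<forall>B X Y c1 c2. M B X Y \<and> reidemeister2 B (fst X) (fst Y) c1 c2 \<longrightarrow> f X c1 = f X c2) \<and>
     (\<forall>B X Y c1 c2 c3 d1 d2 d3.
        M B X Y \<and> reidemeister3 B (fst X) (fst Y) c1 c2 c3 d1 d2 d3 \<longrightarrow>
          card {c \<in> {c1, c2, c3}. f X c = 1} \<in> {3, 0, 2} \<and>
          f X c1 = f Y d1 \<and> f X c2 = f Y d2 \<and> f X c3 = f Y d3)"

definition is_strong_parity ::
    "(complex set \<Rightarrow> vdiagram \<times> 'c \<Rightarrow> vdiagram \<times> 'c \<Rightarrow> bool) \<Rightarrow>
     (vdiagram \<times> 'c \<Rightarrow> complex \<Rightarrow> bit) \<Rightarrow> bool" where
  "is_strong_parity M f \<longleftrightarrow>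
     is_parity M f \<and>
     \<not> (\<exists>B X Y c1 c2 c3 d1 d2 d3.
          M B X Y \<and> reidemeister3 B (fst X) (fst Y) c1 c2 c3 d1 d2 d3 \<and>
          f X c1 = 1 \<and> f X c2 = 1 \<and> f X c3 = 1)"

end

theory Submission
  imports Defs
begin

text \<open>
  Extend a 2-colouring to a function on all points of the circles, giving a flat point the colour of
  the arc that ends there.  Such functions are exactly those which are locally constant except that
  they switch colour just after every flat point; hence the values at two points of a strand agree
  iff the number of flat points between them is even.  Every move leaves the parity of the
  number of flat points on each of its strands unchanged (2 or 0 against 0, 2 against 2, 1
  against 1), so a colouring outside the disc extends in exactly one way to the new strands.

  For the axioms, the two arcs oriented into a crossing have the colours found at the starts of the
  two strands, each switched once for every crossing met earlier.  On a strand with two classical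
  crossings these colours differ.  For a kink this gives an even crossing, for a bigon both
  colours are switched between its crossings.  In a triangle, comparing colours cyclically around
  the three strands gives three switches, so the number of odd crossings is even; reversing the
  order on all three strands switches both colours at every crossing and preserves the parities.
\<close>

section \<open>Arcs and alternating functions\<close>

lemma cis_eq_imp_eq:
  assumes "cis a = cis b" "\<bar>a - b\<bar> < 2 * pi"
  shows "a = b"
proof -
  have "cis (a - b) = 1"
    using assms(1) by (simp add: cis_divide[symmetric])
  then have "cos (a - b) = 1"
    by (metis cis.sel(1) one_complex.sel(1))
  then obtain n :: int where n: "a - b = of_int n * 2 * pi"
    using cos_one_2pi_int by auto
  then have "\<bar>of_int n\<bar> * (2 * pi) < 1 * (2 * pi)"
    using assms(2) by (simp add: abs_mult)
  then have "\<bar>of_int n :: real\<bar> < 1"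
    by (simp add: mult_less_cancel_right)
  then have "n = 0" by linarith
  with n show ?thesis by simp
qed

lemma in_circles_iff: "(i, z) \<in> circles D \<longleftrightarrow> i < ncomp D \<and> norm z = 1"
  by (auto simp: circles_def)

lemma cis_in_circles [simp]: "(i, cis t) \<in> circles D \<longleftrightarrow> i < ncomp D"
  by (simp add: in_circles_iff)

lemma circles_cases:
  assumes "x \<in> circles D"
  obtains i t where "i < ncomp D" "x = (i, cis t)"
proof -
  from assms obtain i z where x: "x = (i, z)" "i < ncomp D" "norm z = 1"
    by (cases x) (auto simp: in_circles_iff)
  then have "z = cis (Arg z)"
    by (metis cis_Arg sgn_div_norm norm_zero zero_neq_one inverse_1 scaleR_one)
  with x show ?thesis by (metis that)
qed

lemma rot_cis [simp]: "rot (i, cis t) e = (i, cis (t + e))"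
  by (simp add: rot_def cis_mult)

lemma rot_0 [simp]: "rot x 0 = x"
  by (simp add: rot_def)

lemma rot_in_circles: "x \<in> circles D \<Longrightarrow> rot x e \<in> circles D"
  by (cases x) (auto simp: rot_def in_circles_iff norm_mult)

lemma continuous_on_rot: "continuous_on A (rot x)"
  unfolding rot_def by (intro continuous_intros)

lemma rot_neq_self:
  assumes "x \<in> circles D" "e \<noteq> 0" "\<bar>e\<bar> < 2 * pi"
  shows "rot x e \<noteq> x"
  using assms by (elim circles_cases) (auto dest!: cis_eq_imp_eq)

lemma tendsto_rot: "(rot x \<longlongrightarrow> x) (nhds 0)"
proof -
  have "isCont (rot x) 0"
    using continuous_on_rot[of UNIV x] by (simp add: continuous_on_eq_continuous_at)
  then show ?thesis
    using tendsto_at_iff_tendsto_nhds[of "rot x" 0] by (simp add: isCont_def)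
qed

lemma eventually_rot_notin:
  assumes "closed K" "x \<notin> K"
  shows "\<forall>\<^sub>F e in nhds 0. rot x e \<notin> K"
  using topological_tendstoD[OF tendsto_rot, of "- K" x] assms by auto

lemma eventually_nhds_sides:
  fixes P :: "real \<Rightarrow> bool"
  assumes "\<forall>\<^sub>F e in nhds 0. P e"
  shows "\<forall>\<^sub>F e in at_right 0. P e" "\<forall>\<^sub>F e in at_right 0. P (- e)"
proof -
  show "\<forall>\<^sub>F e in at_right 0. P e"
    using assms by (auto simp: eventually_at_filter elim: eventually_mono)
  have "\<forall>\<^sub>F e in at_left 0. P e"
    using assms by (auto simp: eventually_at_filter elim: eventually_mono)
  then show "\<forall>\<^sub>F e in at_right 0. P (- e)"
    by (simp add: at_left_minus[of 0] eventually_filtermap)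
qed

text \<open>Since \<open>x\<close> may itself belong to \<open>F\<close>, closedness is applied only
  to \<open>F - {x}\<close>. The point \<open>x\<close> is avoided because a nonzero rotation by
  less than a full turn moves it.\<close>

lemma eventually_rot_notin_finite:
  assumes "finite F" "x \<in> circles D"
  shows "\<forall>\<^sub>F e in at_right 0. rot x e \<notin> F" "\<forall>\<^sub>F e in at_right 0. rot x (- e) \<notin> F"
proof -
  have *: "\<forall>\<^sub>F e in nhds 0. e \<noteq> 0 \<longrightarrow> rot x e \<notin> F"
  proof -
    have "\<forall>\<^sub>F e in nhds 0. rot x e \<notin> F - {x}"
      using assms(1) by (intro eventually_rot_notin finite_imp_closed) auto
    moreover have "\<forall>\<^sub>F e in nhds 0. \<bar>e\<bar> < 2 * pi"
      unfolding eventually_nhds_metric by (rule exI[of _ "2 * pi"]) (simp add: dist_real_def)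
    ultimately show ?thesis
      by eventually_elim (use rot_neq_self[OF assms(2)] in auto)
  qed
  have pos: "\<forall>\<^sub>F e::real in at_right 0. e > 0"
    by (simp add: eventually_at_right_less)
  show "\<forall>\<^sub>F e in at_right 0. rot x e \<notin> F"
    using eventually_nhds_sides(1)[OF *] pos by eventually_elim simp
  show "\<forall>\<^sub>F e in at_right 0. rot x (- e) \<notin> F"
    using eventually_nhds_sides(2)[OF *] pos by eventually_elim simp
qed

lemma finite_flat_points:
  assumes "virtual_link_diagram D"
  shows "finite (flat_points D)"
proof -
  have cl: "classical D \<subseteq> crossings D" "finite (crossings D)"
    and card: "\<And>p. p \<in> crossings D \<Longrightarrow> card (preim D p) = 2"
    using assms unfolding virtual_link_diagram_def generic_immersion_def by blast+
  have "flat_points D = (\<Union>p \<in> classical D. preim D p)"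
    by (auto simp: flat_points_def preim_def)
  moreover have "finite (preim D p)" if "p \<in> classical D" for p
    using card[of p] cl that by (intro card_ge_0_finite) auto
  ultimately show ?thesis
    using finite_subset[OF cl] by auto
qed


section \<open>Arcs of the shadow and their ends at circle points\<close>

lemma components_Int_eq:
  "C \<in> components S \<Longrightarrow> C' \<in> components S \<Longrightarrow> x \<in> C \<Longrightarrow> x \<in> C' \<Longrightarrow> C = C'"
  using components_eq[of C S C'] by auto

lemma arc_at_in_arcs: "x \<in> circles D - flat_points D \<Longrightarrow> arc_at D x \<in> arcs D"
  unfolding arcs_def arc_at_def by (rule componentsI)

lemma arc_at_eqI: "a \<in> arcs D \<Longrightarrow> x \<in> a \<Longrightarrow> arc_at D x = a"
  unfolding arcs_def arc_at_def by (metis components_iff connected_component_eq)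

lemma arcs_subset: "a \<in> arcs D \<Longrightarrow> a \<subseteq> circles D - flat_points D"
  by (simp add: arcs_def in_components_subset)

lemma arcs_nonempty: "a \<in> arcs D \<Longrightarrow> a \<noteq> {}"
  unfolding arcs_def by (rule in_components_nonempty)

lemma rot_interval_subset_arc:
  assumes "x \<in> circles D" "connected I" "e \<in> I" "\<And>e. e \<in> I \<Longrightarrow> rot x e \<notin> flat_points D"
  shows "rot x ` I \<subseteq> arc_at D (rot x e)"
  unfolding arc_at_def
  using assms rot_in_circles[OF assms(1)]
  by (intro connected_component_maximal connected_continuous_image continuous_on_rot) auto

text \<open>A short one-sided segment at \<open>x\<close> contains no flat point, so it lies in a
  single arc. Two arcs containing such segments would meet and hence coincide. The sign
  \<open>\<sigma>\<close> treats the arc before \<open>x\<close> and the arc after \<open>x\<close>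
  together.\<close>

lemma one_sided_arc:
  assumes "finite (flat_points D)" "x \<in> circles D" "\<sigma> \<in> {1, -1}"
  shows "\<exists>!a. a \<in> arcs D \<and> (\<forall>\<^sub>F e in at_right 0. rot x (\<sigma> * e) \<in> a)"
proof (rule ex_ex1I)
  have "\<forall>\<^sub>F e in at_right 0. rot x (\<sigma> * e) \<notin> flat_points D"
    using eventually_rot_notin_finite[OF assms(1,2)] assms(3) by auto
  then obtain d where d: "d > 0" "\<And>e. 0 < e \<Longrightarrow> e < d \<Longrightarrow> rot x (\<sigma> * e) \<notin> flat_points D"
    by (auto simp: eventually_at_right_field)
  define a where "a = arc_at D (rot x (\<sigma> * (d / 2)))"
  have conn: "connected ((\<lambda>e. \<sigma> * e) ` {0<..<d})"
    by (intro connected_continuous_image continuous_intros) auto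
  have "rot x ` (\<lambda>e. \<sigma> * e) ` {0<..<d} \<subseteq> a"
    unfolding a_def using d by (intro rot_interval_subset_arc assms conn imageI) auto
  then have "\<forall>\<^sub>F e in at_right 0. rot x (\<sigma> * e) \<in> a"
    unfolding eventually_at_right_field using d(1)
    by (intro exI[of _ d]) (auto simp: image_subset_iff)
  moreover have "a \<in> arcs D"
    unfolding a_def using d(1) d(2)[of "d / 2"] rot_in_circles[OF assms(2)]
    by (intro arc_at_in_arcs) auto
  ultimately show "\<exists>a. a \<in> arcs D \<and> (\<forall>\<^sub>F e in at_right 0. rot x (\<sigma> * e) \<in> a)"
    by blast
next
  fix a b
  assume a: "a \<in> arcs D \<and> (\<forall>\<^sub>F e in at_right 0. rot x (\<sigma> * e) \<in> a)"
    and b: "b \<in> arcs D \<and> (\<forall>\<^sub>F e in at_right 0. rot x (\<sigma> * e) \<in> b)"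
  then have "\<forall>\<^sub>F e in at_right 0. rot x (\<sigma> * e) \<in> a \<and> rot x (\<sigma> * e) \<in> b"
    by (simp add: eventually_conj_iff)
  then obtain e where "rot x (\<sigma> * e) \<in> a" "rot x (\<sigma> * e) \<in> b"
    using eventually_happens trivial_limit_at_right_real by blast
  then show "a = b"
    using a b components_Int_eq unfolding arcs_def by metis
qed

lemma
  assumes "finite (flat_points D)" "x \<in> circles D"
  shows arc_in_in_arcs: "arc_in D x \<in> arcs D"
    and eventually_arc_in: "\<forall>\<^sub>F e in at_right 0. rot x (- e) \<in> arc_in D x"
    and arc_out_in_arcs: "arc_out D x \<in> arcs D"
    and eventually_arc_out: "\<forall>\<^sub>F e in at_right 0. rot x e \<in> arc_out D x"
  using theI'[OF one_sided_arc[OF assms, of "- 1"]] theI'[OF one_sided_arc[OF assms, of 1]]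
  by (simp_all add: arc_in_def arc_out_def)

text \<open>The definite descriptions also make sense away from the flat points: there both return
  the arc through the point. Thus \<open>C (arc_in D x)\<close> is a colour attached to every point
  of the circles.\<close>

lemma
  assumes "finite (flat_points D)" "x \<in> circles D - flat_points D"
  shows arc_in_nonflat: "arc_in D x = arc_at D x"
    and arc_out_nonflat: "arc_out D x = arc_at D x"
proof -
  have x: "x \<in> circles D" using assms by simp
  have "\<forall>\<^sub>F e in nhds 0. rot x e \<notin> flat_points D"
    using assms by (intro eventually_rot_notin finite_imp_closed) auto
  then obtain d where d: "d > 0" "\<And>e. \<bar>e\<bar> < d \<Longrightarrow> rot x e \<notin> flat_points D"
    by (auto simp: eventually_nhds_metric dist_real_def)
  have "rot x ` {-d<..<d} \<subseteq> arc_at D (rot x 0)"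
    using d by (intro rot_interval_subset_arc x) auto
  then have *: "rot x e \<in> arc_at D x" if "\<bar>e\<bar> < d" for e
    using that by (auto simp: image_subset_iff abs_less_iff)
  have "\<forall>\<^sub>F e in nhds 0. rot x e \<in> arc_at D x"
    using * d(1) by (auto simp: eventually_nhds_metric dist_real_def)
  note sides = eventually_nhds_sides[OF this]
  show "arc_in D x = arc_at D x"
    unfolding arc_in_def
    using one_sided_arc[OF assms(1) x, of "- 1"] arc_at_in_arcs[OF assms(2)] sides
    by (intro the1_equality) auto
  show "arc_out D x = arc_at D x"
    unfolding arc_out_def
    using one_sided_arc[OF assms(1) x, of 1] arc_at_in_arcs[OF assms(2)] sides
    by (intro the1_equality) auto
qed

text \<open>The left-continuous convention assigns the incoming colour to a flat point. With two
  colours, the single equivalence in the second clause expresses both constancy after ordinary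
  points and the switch after flat points.\<close>

definition alternating :: "vdiagram \<Rightarrow> (circle_point \<Rightarrow> colour) \<Rightarrow> bool" where
  "alternating D g \<longleftrightarrow> (\<forall>x \<in> circles D.
     (\<forall>\<^sub>F e in at_right 0. g (rot x (- e)) = g x) \<and>
     (\<forall>\<^sub>F e in at_right 0. g (rot x e) = g x \<longleftrightarrow> x \<notin> flat_points D))"

text \<open>Points just before or just after \<open>x\<close> lie in \<open>arc_in D x\<close> or
  \<open>arc_out D x\<close>. They are not flat, so that arc is also their own incoming arc, and
  only the two arcs at \<open>x\<close> have to be compared.\<close>

lemma two_colouring_imp_alternating:
  assumes fin: "finite (flat_points D)" and C: "two_colouring D C"
  shows "alternating D (\<lambda>x. C (arc_in D x))"
  unfolding alternating_def
proof (intro ballI conjI)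
  fix x assume x: "x \<in> circles D"
  have arc_in_eq: "arc_in D y = a" if "a \<in> arcs D" "y \<in> a" for a y
    using that arcs_subset[OF that(1)] arc_in_nonflat[OF fin] arc_at_eqI by blast
  show "\<forall>\<^sub>F e in at_right 0. C (arc_in D (rot x (- e))) = C (arc_in D x)"
    using eventually_arc_in[OF fin x] by eventually_elim (metis arc_in_eq arc_in_in_arcs[OF fin x])
  have *: "C (arc_out D x) = C (arc_in D x) \<longleftrightarrow> x \<notin> flat_points D"
  proof (cases "x \<in> flat_points D")
    case True
    then show ?thesis
      using C x unfolding two_colouring_def flat_points_def preim_def
      by (metis (mono_tags, lifting) mem_Collect_eq)
  next
    case False
    then show ?thesis
      using x by (simp add: arc_in_nonflat arc_out_nonflat fin)
  qed
  show "\<forall>\<^sub>F e in at_right 0.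
      C (arc_in D (rot x e)) = C (arc_in D x) \<longleftrightarrow> x \<notin> flat_points D"
    using eventually_arc_out[OF fin x]
    by eventually_elim (metis * arc_in_eq arc_out_in_arcs[OF fin x])
qed

text \<open>This passes from angles near 0 to neighbourhoods within the circles. A nearby point
  \<open>y\<close> lies on the same circle because the index is discrete, and it is the rotation of
  \<open>x\<close> by \<open>Arg (snd y / snd x)\<close>, an angle that is continuous at
  \<open>x\<close> with value 0.\<close>

lemma eventually_rot_at_within_circles:
  assumes "x \<in> circles D" "\<forall>\<^sub>F e in nhds 0. P (rot x e)"
  shows "\<forall>\<^sub>F y in at x within circles D. P y"
proof -
  define \<phi> where "\<phi> y = Arg (snd y / snd x)" for y :: circle_point
  have nz: "snd x \<noteq> 0"
    using assms(1) by (cases x) (auto simp: in_circles_iff)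
  have "isCont (\<lambda>y. Arg (snd y / snd x)) x"
    using nz by (intro continuous_intros isCont_o2[OF _ continuous_at_Arg]) auto
  then have "(\<phi> \<longlongrightarrow> 0) (at x within circles D)"
    using nz unfolding \<phi>_def isCont_def by (auto intro: tendsto_within_subset)
  then have "\<forall>\<^sub>F y in at x within circles D. P (rot x (\<phi> y))"
    using assms(2) by (auto simp: filterlim_iff)
  moreover have "\<forall>\<^sub>F y in at x within circles D. fst y \<in> {fst x}"
    by (intro topological_tendstoD[OF tendsto_fst[OF tendsto_ident_at]]) (auto simp: open_discrete)
  moreover have "\<forall>\<^sub>F y in at x within circles D. y \<in> circles D"
    by (simp add: eventually_at_filter)
  ultimately show ?thesis
  proof eventually_elim
    case (elim y)
    have n: "norm (snd y) = 1" "norm (snd x) = 1"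
      using elim(3) assms(1) by (auto simp: circles_def)
    then have "cis (Arg (snd y / snd x)) = snd y / snd x"
      using nz by (subst cis_Arg) (auto simp: sgn_div_norm norm_divide)
    then have "rot x (\<phi> y) = y"
      using elim(2) nz by (auto simp: rot_def \<phi>_def prod_eq_iff)
    with elim(1) show ?case by simp
  qed
qed

lemma nhds_0_from_sides:
  assumes "P (0::real)" "\<forall>\<^sub>F e in at_right 0. P e" "\<forall>\<^sub>F e in at_right 0. P (- e)"
  shows "\<forall>\<^sub>F e in nhds 0. P e"
proof -
  have "\<forall>\<^sub>F e in at_left 0. P e"
    using assms(3) by (simp add: at_left_minus[of 0] eventually_filtermap)
  then have "\<forall>\<^sub>F e in at 0. P e"
    using assms(2) by (simp add: eventually_at_split)
  then show ?thesis
    using assms(1) by (auto simp: eventually_at_filter elim!: eventually_mono)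
qed

text \<open>An arc is connected and contains no flat points, so an alternating function is locally
  constant on it and therefore constant. The colours at the two sides of a flat point are then read
  off from points close to it.\<close>

lemma alternating_imp_two_colouring:
  assumes fin: "finite (flat_points D)" and g: "alternating D g"
  obtains C where "two_colouring D C" "\<And>x. x \<in> circles D \<Longrightarrow> C (arc_in D x) = g x"
proof -
  have const: "g x = g y" if a: "a \<in> arcs D" and xy: "x \<in> a" "y \<in> a" for a x y
  proof (rule connected_local_const[of a])
    show "connected a"
      using a by (auto simp: arcs_def in_components_connected)
    show "\<forall>x \<in> a. \<forall>\<^sub>F y in at x within a. g x = g y"
    proof
      fix x assume "x \<in> a"
      then have x: "x \<in> circles D" "x \<notin> flat_points D"
        using arcs_subset[OF a] by auto
      then have "\<forall>\<^sub>F e in at_right 0. g (rot x (- e)) = g x"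
          "\<forall>\<^sub>F e in at_right 0. g (rot x e) = g x"
        using bspec[OF g[unfolded alternating_def] x(1)] x(2) by simp_all
      then have "\<forall>\<^sub>F e in nhds 0. g x = g (rot x e)"
        by (intro nhds_0_from_sides) (simp_all add: eq_commute[of "g x"])
      then have "\<forall>\<^sub>F y in at x within circles D. g x = g y"
        by (rule eventually_rot_at_within_circles[OF x(1)])
      then show "\<forall>\<^sub>F y in at x within a. g x = g y"
        using arcs_subset[OF a] by (intro filter_leD[OF at_le[of a "circles D" x]]) auto
    qed
  qed (use xy in auto)
  \<comment> \<open>By \<open>const\<close> the chosen point of the arc does not matter; restricting
    the function to \<open>arcs D\<close> gives the extensionality demanded of a colouring.\<close>
  define C where "C = (\<lambda>a \<in> arcs D. g (SOME x. x \<in> a))"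
  have C: "C a = g x" if "a \<in> arcs D" "x \<in> a" for a x
    using that const[OF that(1) someI[of "\<lambda>y. y \<in> a"] that(2)] by (auto simp: C_def)
  have ain: "C (arc_in D x) = g x" if x: "x \<in> circles D" for x
  proof -
    have "\<forall>\<^sub>F e in at_right 0. rot x (- e) \<in> arc_in D x \<and> g (rot x (- e)) = g x"
      using eventually_arc_in[OF fin x] g x by (auto simp: alternating_def eventually_conj_iff)
    then obtain e where "rot x (- e) \<in> arc_in D x" "g (rot x (- e)) = g x"
      using eventually_happens trivial_limit_at_right_real by blast
    then show ?thesis
      using C[OF arc_in_in_arcs[OF fin x]] by metis
  qed
  have aout: "C (arc_out D x) \<noteq> g x" if x: "x \<in> flat_points D" for x
  proof -
    have x': "x \<in> circles D" using x by (simp add: flat_points_def)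
    have "\<forall>\<^sub>F e in at_right 0. rot x e \<in> arc_out D x \<and> g (rot x e) \<noteq> g x"
      using eventually_arc_out[OF fin x'] g x x' by (auto simp: alternating_def eventually_conj_iff)
    then obtain e where "rot x e \<in> arc_out D x" "g (rot x e) \<noteq> g x"
      using eventually_happens trivial_limit_at_right_real by blast
    then show ?thesis
      using C[OF arc_out_in_arcs[OF fin x']] by metis
  qed
  have "two_colouring D C"
    unfolding two_colouring_def
  proof (intro conjI ballI)
    show "C \<in> arcs D \<rightarrow>\<^sub>E UNIV" by (auto simp: C_def)
    fix p x assume "p \<in> classical D" "x \<in> preim D p"
    then have "x \<in> flat_points D" "x \<in> circles D"
      by (auto simp: flat_points_def preim_def)
    then show "C (arc_in D x) \<noteq> C (arc_out D x)"
      using ain aout by metis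
  qed
  with ain that show ?thesis by blast
qed


section \<open>Counting flat points along a strand\<close>

text \<open>There are only two colours, so a comparison with a reference colour \<open>u\<close>
  determines a colour. Later this cancels the colour at the start of a strand.\<close>

lemma colour_same_iff:
  fixes u v w :: colour
  shows "(v = u \<longleftrightarrow> w = u) \<longleftrightarrow> v = w"
  by (cases u; cases v; cases w) auto

text \<open>The interval is closed on the left and open on the right because a flat point keeps its
  incoming colour: a switch at \<open>t\<close> affects later points, whereas a switch at
  \<open>u\<close> does not yet affect \<open>u\<close>.\<close>

definition flat_params :: "vdiagram \<Rightarrow> nat \<Rightarrow> real \<Rightarrow> real \<Rightarrow> real set" where
  "flat_params D i t u = {s \<in> {t..<u}. (i, cis s) \<in> flat_points D}"

lemma inj_on_cis_param:
  assumes "\<And>s s'. s \<in> A \<Longrightarrow> s' \<in> A \<Longrightarrow> \<bar>s - s'\<bar> < 2 * pi"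
  shows "inj_on (\<lambda>s. (i, cis s)) A"
  using assms by (auto intro!: inj_onI cis_eq_imp_eq)

lemma finite_flat_params:
  assumes "finite (flat_points D)" "u \<le> t + 2 * pi"
  shows "finite (flat_params D i t u)"
proof -
  have "inj_on (\<lambda>s. (i, cis s)) {t..<u}"
    using assms(2) by (intro inj_on_cis_param) (auto simp: abs_less_iff)
  from finite_vimage_IntI[OF assms(1) this] show ?thesis
    by (rule finite_subset[rotated]) (auto simp: flat_params_def)
qed

lemma eventually_flat_params_left:
  assumes "finite (flat_points D)" "i < ncomp D"
  shows "\<forall>\<^sub>F e in at_right 0. flat_params D i a (t - e) = flat_params D i a t"
proof -
  have "\<forall>\<^sub>F e in at_right 0. rot (i, cis t) (- e) \<notin> flat_points D"
    using assms by (intro eventually_rot_notin_finite) auto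
  then obtain d where d: "d > 0" "\<And>e. 0 < e \<Longrightarrow> e < d \<Longrightarrow> (i, cis (t - e)) \<notin> flat_points D"
    by (auto simp: eventually_at_right_field)
  have "s < t - e" if "s < t" "e < d" "(i, cis s) \<in> flat_points D" for s e
    using d(2)[of "t - s"] that by (cases "s < t - e") auto
  then have "flat_params D i a (t - e) = flat_params D i a t" if "0 < e" "e < d" for e
    using that by (fastforce simp: flat_params_def)
  then show ?thesis
    using d(1) by (auto simp: eventually_at_right_field)
qed

text \<open>Flat points do not accumulate, so a short step past \<open>t\<close> can add only the
  parameter \<open>t\<close> itself, and does so exactly when that point is flat.\<close>

lemma eventually_flat_params_right:
  assumes "finite (flat_points D)" "i < ncomp D" "a \<le> t"
  shows "\<forall>\<^sub>F e in at_right 0. flat_params D i a (t + e) =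
    (if (i, cis t) \<in> flat_points D then insert t (flat_params D i a t) else flat_params D i a t)"
proof -
  have "\<forall>\<^sub>F e in at_right 0. rot (i, cis t) e \<notin> flat_points D"
    using assms by (intro eventually_rot_notin_finite) auto
  then obtain d where d: "d > 0" "\<And>e. 0 < e \<Longrightarrow> e < d \<Longrightarrow> (i, cis (t + e)) \<notin> flat_points D"
    by (auto simp: eventually_at_right_field)
  have *: "s \<le> t" if "s < t + e" "e < d" "(i, cis s) \<in> flat_points D" for s e
    using d(2)[of "s - t"] that by (cases "s \<le> t") auto
  have "flat_params D i a (t + e) =
    (if (i, cis t) \<in> flat_points D then insert t (flat_params D i a t) else flat_params D i a t)"
    if "0 < e" "e < d" for e
    using that assms(3) *[OF _ that(2)] by (auto simp: flat_params_def order_le_less)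
  then show ?thesis
    using d(1) by (auto simp: eventually_at_right_field)
qed

lemma even_card_flat_params_insert:
  assumes "finite (flat_points D)" "t \<le> a + 2 * pi"
  shows "even (card (insert t (flat_params D i a t))) \<longleftrightarrow> odd (card (flat_params D i a t))"
proof -
  have "t \<notin> flat_params D i a t" by (simp add: flat_params_def)
  then show ?thesis
    using finite_flat_params[OF assms] by simp
qed

text \<open>The claim, viewed as a truth value depending on the right end, is locally constant on a
  connected interval: colour and count parity change together just after a flat point and nowhere
  else. It holds at \<open>t\<close>, where the count is zero.\<close>

lemma alternating_eq_iff_even:
  assumes fin: "finite (flat_points D)" and g: "alternating D g"
    and i: "i < ncomp D" and tu: "t \<le> u" "u \<le> t + 2 * pi"
  shows "g (i, cis u) = g (i, cis t) \<longleftrightarrow> even (card (flat_params D i t u))"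
proof -
  define h where
    "h v \<longleftrightarrow> (g (i, cis v) = g (i, cis t) \<longleftrightarrow> even (card (flat_params D i t v)))" for v
  have "h t = h u"
  proof (rule connected_local_const[of "{t..u}"])
    show "\<forall>v \<in> {t..u}. \<forall>\<^sub>F w in at v within {t..u}. h v = h w"
    proof
      fix v assume v: "v \<in> {t..u}"
      then have tv: "t \<le> v" by simp
      have alt: "\<forall>\<^sub>F e in at_right 0. g (i, cis (v - e)) = g (i, cis v)"
        "\<forall>\<^sub>F e in at_right 0. g (i, cis (v + e)) = g (i, cis v) \<longleftrightarrow> (i, cis v) \<notin> flat_points D"
        using bspec[OF g[unfolded alternating_def], of "(i, cis v)"] i by auto
      have "\<forall>\<^sub>F e in at_right 0. h v = h (v + - e)"
        using alt(1) eventually_flat_params_left[OF fin i, of t v]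
        by eventually_elim (simp add: h_def)
      moreover have "\<forall>\<^sub>F e in at_right 0. h v = h (v + e)"
        using alt(2) eventually_flat_params_right[OF fin i tv]
      proof eventually_elim
        case (elim e)
        have "even (card (insert v (flat_params D i t v))) \<longleftrightarrow> odd (card (flat_params D i t v))"
          using v tu by (intro even_card_flat_params_insert fin) auto
        then show ?case
          using elim colour_same_iff[of "g (i, cis (v + e))" "g (i, cis t)" "g (i, cis v)"]
          unfolding h_def by (cases "(i, cis v) \<in> flat_points D") simp_all
      qed
      ultimately have "\<forall>\<^sub>F e in nhds 0. h v = h (v + e)"
        by (intro nhds_0_from_sides) simp_all
      then obtain d where d: "d > 0" "\<And>e. \<bar>e\<bar> < d \<Longrightarrow> h v = h (v + e)"
        by (auto simp: eventually_nhds_metric dist_real_def)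
      have "h v = h w" if "dist w v < d" for w
        using d(2)[of "w - v"] that by (simp add: dist_real_def)
      then show "\<forall>\<^sub>F w in at v within {t..u}. h v = h w"
        using d(1) by (auto simp: eventually_at)
    qed
  qed (use tu in auto)
  moreover have "h t" by (simp add: h_def flat_params_def)
  ultimately show ?thesis by (simp add: h_def)
qed

lemma strand_arcI: "t \<in> {a..b} \<Longrightarrow> (i, cis t) \<in> strand_arc (i, a, b)"
  by (simp add: strand_arc_def)

lemma strand_arcE:
  assumes "x \<in> strand_arc (i, a, b)"
  obtains t where "x = (i, cis t)" "t \<in> {a..b}"
  using assms by (auto simp: strand_arc_def)

fun start :: "strand \<Rightarrow> circle_point" where
  "start (i, a, b) = (i, cis a)"

section \<open>The strands of one diagram inside a disc\<close>

locale disc_diagram =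
  fixes B :: "complex set" and S :: "strand list" and D :: vdiagram
  assumes diagram: "virtual_link_diagram D" and meets: "meets_disc_in B S D"
begin

lemma finite_flat: "finite (flat_points D)"
  by (rule finite_flat_points[OF diagram])

lemma strand_bounds:
  assumes "(i, a, b) \<in> set S"
  shows "i < ncomp D" "a < b" "b < a + 2 * pi"
  using conjunct1[OF meets[unfolded meets_disc_in_def]] assms by auto

lemma strands_disjoint:
  assumes "j < length S" "k < length S" "j \<noteq> k"
  shows "strand_arc (S ! j) \<inter> strand_arc (S ! k) = {}"
  using meets assms by (simp add: meets_disc_in_def disjoint_family_on_def)

lemma strand_unique:
  assumes "s \<in> set S" "s' \<in> set S" "x \<in> strand_arc s" "x \<in> strand_arc s'"
  shows "s = s'"
proof -
  obtain j k where "j < length S" "s = S ! j" "k < length S" "s' = S ! k"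
    using assms(1,2) by (auto simp: in_set_conv_nth)
  with strands_disjoint[of j k] assms(3,4) show ?thesis by (cases "j = k") auto
qed

lemma strand_inj:
  assumes "(i, a, b) \<in> set S" "cis t = cis u" "t \<in> {a..b}" "u \<in> {a..b}"
  shows "t = u"
  using strand_bounds[OF assms(1)] assms(2-) by (intro cis_eq_imp_eq) (auto simp: abs_less_iff)

lemma strand_arc_subset: "s \<in> set S \<Longrightarrow> strand_arc s \<subseteq> circles D"
  using strand_bounds(1) by (cases s) (auto simp: strand_arc_def)

lemma in_disc_iff:
  assumes "x \<in> circles D"
  shows "curve D x \<in> B \<longleftrightarrow> x \<in> (\<Union>s \<in> set S. strand_arc s)"
proof -
  have "{x \<in> circles D. curve D x \<in> B} = (\<Union>s \<in> set S. strand_arc s)"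
    using meets by (simp add: meets_disc_in_def)
  with assms show ?thesis by blast
qed

text \<open>Classical crossings are crossings and so avoid the frontier of \<open>B\<close>. The
  point therefore maps to the interior, lies inside some strand, and disjointness of strands shows
  that this strand is \<open>s\<close>.\<close>

lemma flat_in_interior:
  assumes "s \<in> set S" "x \<in> strand_arc s" "x \<in> flat_points D"
  shows "x \<in> strand_interior s"
proof -
  have x: "x \<in> circles D" "curve D x \<in> B"
    using assms strand_arc_subset in_disc_iff by blast+
  have "curve D x \<in> crossings D"
    using assms(3) diagram by (auto simp: flat_points_def virtual_link_diagram_def)
  then have "curve D x \<notin> frontier B"
    using meets by (auto simp: meets_disc_in_def)
  then have "curve D x \<in> interior B"
    using x(2) closure_subset[of B] by (auto simp: frontier_def)
  then obtain s' where s': "s' \<in> set S" "x \<in> strand_interior s'"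
    using meets x(1) unfolding meets_disc_in_def by blast
  then have "x \<in> strand_arc s'"
    by (cases s') (auto simp: strand_arc_def strand_interior_def)
  with s' strand_unique[OF assms(1) s'(1) assms(2)] show ?thesis by simp
qed

lemma endpoints_not_flat:
  assumes "(i, a, b) \<in> set S"
  shows "(i, cis a) \<notin> flat_points D" "(i, cis b) \<notin> flat_points D"
proof -
  have "(i, cis t) \<notin> flat_points D" if "t \<in> {a, b}" for t
  proof
    assume fl: "(i, cis t) \<in> flat_points D"
    have "(i, cis t) \<in> strand_arc (i, a, b)"
      using that strand_bounds[OF assms] by (auto simp: strand_arc_def)
    from flat_in_interior[OF assms this fl]
    obtain u where "u \<in> {a<..<b}" "cis t = cis u"
      by (auto simp: strand_interior_def)
    with strand_inj[OF assms, of t u] that strand_bounds[OF assms] show False by auto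
  qed
  then show "(i, cis a) \<notin> flat_points D" "(i, cis b) \<notin> flat_points D" by auto
qed

text \<open>The half-open count omits the endpoint \<open>b\<close>, but endpoints of strands are
  never flat. Injectivity holds because a strand is shorter than a full turn.\<close>

lemma card_flat_params:
  assumes "(i, a, b) \<in> set S"
  shows "card (flat_params D i a b) = card (strand_arc (i, a, b) \<inter> flat_points D)"
proof (rule bij_betw_same_card[of "\<lambda>t. (i, cis t)"], unfold bij_betw_def, intro conjI)
  show "inj_on (\<lambda>t. (i, cis t)) (flat_params D i a b)"
    using strand_inj[OF assms] by (auto simp: inj_on_def flat_params_def)
  show "(\<lambda>t. (i, cis t)) ` flat_params D i a b = strand_arc (i, a, b) \<inter> flat_points D"
    using endpoints_not_flat[OF assms]
    by (force simp: flat_params_def strand_arc_def order_le_less)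
qed

lemma strand_colour:
  assumes "alternating D g" "(i, a, b) \<in> set S" "t \<in> {a..b}"
  shows "g (i, cis t) = g (i, cis a) \<longleftrightarrow> even (card (flat_params D i a t))"
  using alternating_eq_iff_even[OF finite_flat assms(1), of i a t]
    strand_bounds[OF assms(2)] assms(3)
  by auto

text \<open>No switch occurs between the start of the strand and its only flat point.\<close>

lemma one_flat:
  assumes "alternating D g" "s \<in> set S" "strand_arc s \<inter> flat_points D = {x}"
  shows "g x = g (start s)"
proof -
  obtain i a b where s: "s = (i, a, b)" by (cases s)
  obtain t where t: "x = (i, cis t)" "t \<in> {a..b}"
    using assms(3) strand_arcE[of x i a b] unfolding s by blast
  have "u = t" if "u \<in> {a..b}" "(i, cis u) \<in> flat_points D" for u
  proof -
    have "(i, cis u) \<in> strand_arc s" using that by (auto simp: s strand_arc_def)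
    with that assms(3) t have "cis u = cis t" by auto
    then show ?thesis using strand_inj assms(2) s that t by blast
  qed
  then have "flat_params D i a t = {}"
    using t by (force simp: flat_params_def)
  then show ?thesis
    using strand_colour[OF assms(1) assms(2)[unfolded s] t(2)] by (simp add: s t)
qed

text \<open>The earlier flat point has the start colour, the later one comes after exactly one
  switch. Hence comparing with the start colour detects the order. The order claim assumes distinct
  images since \<open>before\<close> compares points of the plane; the first claim also covers the
  self-crossing of a kink.\<close>

lemma two_flats:
  assumes g: "alternating D g" and s: "s \<in> set S"
    and xy: "strand_arc s \<inter> flat_points D = {x, y}" "x \<noteq> y"
  shows "g x \<noteq> g y"
    and "curve D x \<noteq> curve D y \<Longrightarrow> before D s (curve D x) (curve D y) \<longleftrightarrow> g x = g (start s)"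
proof -
  obtain i a b where s_eq [simp]: "s = (i, a, b)" by (cases s)
  have "x \<in> strand_arc (i, a, b)" "y \<in> strand_arc (i, a, b)"
    using xy by auto
  then obtain t u where t: "x = (i, cis t)" "t \<in> {a..b}" and u: "y = (i, cis u)" "u \<in> {a..b}"
    by (elim strand_arcE)
  have inj: "v = w" if "cis v = cis w" "v \<in> {a..b}" "w \<in> {a..b}" for v w
    using strand_inj s that by auto
  have flat: "(i, cis v) \<in> flat_points D \<longleftrightarrow> v = t \<or> v = u" if "v \<in> {a..b}" for v
  proof -
    have "(i, cis v) \<in> strand_arc s" using that by (auto simp: strand_arc_def)
    with xy(1) have "(i, cis v) \<in> flat_points D \<longleftrightarrow> cis v = cis t \<or> cis v = cis u"
      using t(1) u(1) by auto
    then show ?thesis using inj that t(2) u(2) by metis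
  qed
  have fp: "flat_params D i a v = {w \<in> {t, u}. w < v}" if "v \<in> {a..b}" for v
    using that t u flat by (force simp: flat_params_def)
  have "t \<noteq> u" using xy(2) t(1) u(1) by auto
  then have "flat_params D i a t = (if t < u then {} else {u})"
    "flat_params D i a u = (if t < u then {t} else {})"
    unfolding fp[OF t(2)] fp[OF u(2)] by (auto simp: not_less order_le_less)
  then have gx: "g x = g (start s) \<longleftrightarrow> t < u" and gy: "g y = g (start s) \<longleftrightarrow> \<not> t < u"
    using strand_colour[OF g s[simplified], of t] strand_colour[OF g s[simplified], of u] t u
    by auto
  show "g x \<noteq> g y" using gx gy by auto
  assume neq: "curve D x \<noteq> curve D y"
  \<comment> \<open>This translates \<open>before\<close> back to parameters: a strand point over
    either crossing is flat, so its parameter is \<open>t\<close> or \<open>u\<close>, and distinct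
    images decide which.\<close>
  have mem: "v = (if curve D (i, cis v) = curve D x then t else u)"
    if "v \<in> {a..b}" "curve D (i, cis v) \<in> {curve D x, curve D y}" for v
  proof -
    have "x \<in> flat_points D" "y \<in> flat_points D" using xy by auto
    then have "(i, cis v) \<in> flat_points D"
      using that strand_bounds[OF s[simplified]] by (auto simp: flat_points_def)
    then show ?thesis using flat[OF that(1)] t u neq by auto
  qed
  have "before D s (curve D x) (curve D y) \<longleftrightarrow> t < u"
  proof
    assume "before D s (curve D x) (curve D y)"
    then obtain v w where "v \<in> {a..b}" "w \<in> {a..b}" "v < w"
      "curve D (i, cis v) = curve D x" "curve D (i, cis w) = curve D y"
      by (auto simp: before_def)
    with mem[of v] mem[of w] neq show "t < u" by auto
  next
    assume "t < u"
    then show "before D s (curve D x) (curve D y)"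
      unfolding before_def s_eq prod.case using t u by blast
  qed
  then show "before D s (curve D x) (curve D y) \<longleftrightarrow> g x = g (start s)" by (simp only: gx)
qed

text \<open>These are the strand points whose immediate past also lies on the strand: the starting
  points are removed. Dually, \<open>right_inner\<close> removes the final points.\<close>

definition left_inner :: "circle_point set" where
  "left_inner = (\<Union>(i, a, b) \<in> set S. (\<lambda>t. (i, cis t)) ` {a<..b})"

definition right_inner :: "circle_point set" where
  "right_inner = (\<Union>(i, a, b) \<in> set S. (\<lambda>t. (i, cis t)) ` {a..<b})"

lemma left_innerE:
  assumes "x \<in> left_inner"
  obtains i a b t where "(i, a, b) \<in> set S" "t \<in> {a<..b}" "x = (i, cis t)"
  using assms by (auto simp: left_inner_def)

lemma left_inner_subset: "left_inner \<subseteq> (\<Union>s \<in> set S. strand_arc s)"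
proof
  fix x assume "x \<in> left_inner"
  then obtain i a b t where "(i, a, b) \<in> set S" "t \<in> {a<..b}" "x = (i, cis t)"
    by (rule left_innerE)
  then show "x \<in> (\<Union>s \<in> set S. strand_arc s)"
    by (auto simp: strand_arc_def intro!: bexI[of _ "(i, a, b)"])
qed

lemma right_innerE:
  assumes "x \<in> right_inner"
  obtains i a b t where "(i, a, b) \<in> set S" "t \<in> {a..<b}" "x = (i, cis t)"
  using assms by (auto simp: right_inner_def)

lemma start_notin_left_inner:
  assumes "(i, a, b) \<in> set S"
  shows "(i, cis a) \<notin> left_inner"
proof
  assume "(i, cis a) \<in> left_inner"
  then obtain i' a' b' t where t: "(i', a', b') \<in> set S" "t \<in> {a'<..b'}" "(i, cis a) = (i', cis t)"
    by (rule left_innerE)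
  then have "(i, cis a) \<in> strand_arc (i', a', b')"
    by (auto simp: strand_arc_def)
  moreover have "(i, cis a) \<in> strand_arc (i, a, b)"
    using strand_bounds[OF assms] by (auto simp: strand_arc_def)
  ultimately have "(i, a, b) = (i', a', b')"
    using strand_unique assms t(1) by blast
  with t strand_inj[OF assms, of a t] show False by auto
qed

text \<open>A strand not containing \<open>x\<close> is compact, so it is avoided nearby. Otherwise
  \<open>x\<close> is the start (or the end) of the strand, and a step shorter than
  \<open>a + 2 * pi - b\<close>, the length of the rest of the circle, cannot reach the strand from
  the other side.\<close>

lemma eventually_outside:
  assumes "x \<in> circles D"
  shows "x \<notin> left_inner \<Longrightarrow> \<forall>\<^sub>F e in at_right 0. rot x (- e) \<notin> (\<Union>s \<in> set S. strand_arc s)"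
    and "x \<notin> right_inner \<Longrightarrow> \<forall>\<^sub>F e in at_right 0. rot x e \<notin> (\<Union>s \<in> set S. strand_arc s)"
proof -
  have away: "(\<forall>\<^sub>F e in at_right 0. rot x (- e) \<notin> strand_arc s) \<and>
      (\<forall>\<^sub>F e in at_right 0. rot x e \<notin> strand_arc s)" if "x \<notin> strand_arc s" for s
  proof -
    have "compact (strand_arc s)"
      unfolding strand_arc_def
      by (cases s) (auto intro!: compact_continuous_image continuous_intros)
    then have "\<forall>\<^sub>F e in nhds 0. rot x e \<notin> strand_arc s"
      using that by (intro eventually_rot_notin compact_imp_closed)
    from eventually_nhds_sides[OF this] show ?thesis by simp
  qed
  have small: "\<forall>\<^sub>F e::real in at_right 0. 0 < e \<and> e < d" if "d > 0" for d
    using that by (auto simp: eventually_at_right_field)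
  {
    assume x: "x \<notin> left_inner"
    have "\<forall>\<^sub>F e in at_right 0. rot x (- e) \<notin> strand_arc s" if s: "s \<in> set S" for s
    proof (cases "x \<in> strand_arc s")
      case True
      obtain i a b where [simp]: "s = (i, a, b)" by (cases s)
      note bounds = strand_bounds[OF s[simplified]]
      have xa: "x = (i, cis a)"
        using True x s by (force simp: strand_arc_def left_inner_def order_le_less)
      have "\<forall>\<^sub>F e::real in at_right 0. 0 < e \<and> e < a + 2 * pi - b"
        using bounds by (intro small) auto
      then show ?thesis
      proof eventually_elim
        case (elim e)
        have "a - e = t" if "cis (a - e) = cis t" "t \<in> {a..b}" for t
          using that elim by (intro cis_eq_imp_eq) (auto simp: abs_less_iff)
        with elim show ?case by (fastforce simp: xa strand_arc_def)
      qed
    qed (use away in auto)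
    then show "\<forall>\<^sub>F e in at_right 0. rot x (- e) \<notin> (\<Union>s \<in> set S. strand_arc s)"
      by (simp add: eventually_ball_finite_distrib)
  }
  {
    assume x: "x \<notin> right_inner"
    have "\<forall>\<^sub>F e in at_right 0. rot x e \<notin> strand_arc s" if s: "s \<in> set S" for s
    proof (cases "x \<in> strand_arc s")
      case True
      obtain i a b where [simp]: "s = (i, a, b)" by (cases s)
      note bounds = strand_bounds[OF s[simplified]]
      have xb: "x = (i, cis b)"
        using True x s by (force simp: strand_arc_def right_inner_def order_le_less)
      have "\<forall>\<^sub>F e::real in at_right 0. 0 < e \<and> e < a + 2 * pi - b"
        using bounds by (intro small) auto
      then show ?thesis
      proof eventually_elim
        case (elim e)
        have "b + e = t" if "cis (b + e) = cis t" "t \<in> {a..b}" for t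
          using that elim by (intro cis_eq_imp_eq) (auto simp: abs_less_iff)
        with elim show ?case by (fastforce simp: xb strand_arc_def)
      qed
    qed (use away in auto)
    then show "\<forall>\<^sub>F e in at_right 0. rot x e \<notin> (\<Union>s \<in> set S. strand_arc s)"
      by (simp add: eventually_ball_finite_distrib)
  }
qed

end


section \<open>Transport across a disc\<close>

locale local_move =
  fixes B :: "complex set" and S :: "strand list" and D D' :: vdiagram
  assumes change: "local_change B S D D'"
begin

sublocale disc_diagram B S D
  using change by unfold_locales (auto simp: local_change_def)

sublocale D': disc_diagram B S D'
  using change by unfold_locales (auto simp: local_change_def)

lemma circles_eq: "circles D' = circles D"
  using change by (simp add: local_change_def circles_def)

lemma curve_eq_outside:
  assumes "x \<in> circles D" "x \<notin> (\<Union>s \<in> set S. strand_arc s)"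
  shows "curve D x = curve D' x"
proof -
  have "strand_interior s \<subseteq> strand_arc s" for s
    by (cases s) (auto simp: strand_interior_def strand_arc_def)
  then have "x \<in> circles D - (\<Union>s \<in> set S. strand_interior s)"
    using assms by blast
  then show ?thesis using change unfolding local_change_def by blast
qed

lemma flat_iff_outside:
  assumes "x \<in> circles D" "x \<notin> (\<Union>s \<in> set S. strand_arc s)"
  shows "x \<in> flat_points D' \<longleftrightarrow> x \<in> flat_points D"
proof -
  have "classical D - B = classical D' - B"
    using change by (simp add: local_change_def)
  moreover have "curve D x \<notin> B" using in_disc_iff assms by simp
  ultimately show ?thesis
    using curve_eq_outside[OF assms] assms circles_eq by (auto simp: flat_points_def)
qed

text \<open>Agreement is assumed only off the disc, but incoming colours are left limits. It
  therefore extends to points whose immediate past is off the strands, in particular to the starts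
  of strands on the boundary of the disc.\<close>

lemma left_colour_agree:
  assumes C: "two_colouring D C" and C': "two_colouring D' C'"
    and agree: "agree_outside B (D, C) (D', C')"
    and x: "x \<in> circles D" "x \<notin> left_inner"
  shows "C (arc_in D x) = C' (arc_in D' x)"
proof -
  have x': "x \<in> circles D'" using x circles_eq by simp
  have "\<forall>\<^sub>F e in at_right 0. rot x (- e) \<notin> (\<Union>s \<in> set S. strand_arc s) \<and>
    rot x (- e) \<notin> flat_points D \<and>
    C (arc_in D (rot x (- e))) = C (arc_in D x) \<and>
    C' (arc_in D' (rot x (- e))) = C' (arc_in D' x)"
    using eventually_outside(1)[OF x] eventually_rot_notin_finite(2)[OF finite_flat x(1)]
      two_colouring_imp_alternating[OF finite_flat C]
      two_colouring_imp_alternating[OF D'.finite_flat C'] x(1) x'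
    unfolding alternating_def by (auto simp: eventually_conj_iff)
  \<comment> \<open>A single small step back meets all four requirements: it leaves the strands,
    avoids flat points, and preserves the incoming colour in both diagrams.\<close>
  then obtain e where e: "rot x (- e) \<notin> (\<Union>s \<in> set S. strand_arc s)"
    "rot x (- e) \<notin> flat_points D"
    "C (arc_in D (rot x (- e))) = C (arc_in D x)"
    "C' (arc_in D' (rot x (- e))) = C' (arc_in D' x)"
    using eventually_happens trivial_limit_at_right_real by blast
  define y where "y = rot x (- e)"
  have y: "y \<in> circles D" "y \<in> circles D'"
    using x(1) x' by (auto simp: y_def intro: rot_in_circles)
  have "curve D y \<notin> B"
    using in_disc_iff[OF y(1)] e(1) by (simp add: y_def)
  then have "C (arc_at D y) = C' (arc_at D' y)"
    using agree y e(2) by (simp add: agree_outside_def y_def)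
  moreover have "arc_in D y = arc_at D y" "arc_in D' y = arc_at D' y"
    using arc_in_nonflat finite_flat D'.finite_flat e(1,2) y flat_iff_outside[OF y(1)]
    by (auto simp: y_def)
  ultimately show ?thesis using e(3,4) by (simp add: y_def)
qed

lemma start_colour_agree:
  assumes "two_colouring D C" "two_colouring D' C'" "agree_outside B (D, C) (D', C')"
    and "s \<in> set S"
  shows "C (arc_in D (start s)) = C' (arc_in D' (start s))"
  using left_colour_agree[OF assms(1-3), of "start s"] assms(4)
    start_notin_left_inner strand_bounds(1)
  by (cases s) auto

text \<open>Off \<open>left_inner\<close> the colours are forced by agreement outside the disc.
  Along a strand they are forced by the start colour and the number of flat points of
  \<open>D'\<close> passed.\<close>

lemma transport_unique:
  assumes "two_colouring D C"
    and C1: "two_colouring D' C1" "agree_outside B (D, C) (D', C1)"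
    and C2: "two_colouring D' C2" "agree_outside B (D, C) (D', C2)"
  shows "C1 = C2"
proof -
  have off: "C1 (arc_in D' x) = C2 (arc_in D' x)" if "x \<in> circles D" "x \<notin> left_inner" for x
    using left_colour_agree[OF assms(1) C1 that] left_colour_agree[OF assms(1) C2 that] by simp
  have g: "C1 (arc_in D' x) = C2 (arc_in D' x)" if x: "x \<in> circles D" for x
  proof (cases "x \<in> left_inner")
    case True
    then obtain i a b t where s: "(i, a, b) \<in> set S" "t \<in> {a<..b}" "x = (i, cis t)"
      by (rule left_innerE)
    have "C1 (arc_in D' (i, cis a)) = C2 (arc_in D' (i, cis a))"
      using off start_notin_left_inner s strand_bounds[OF s(1)] by simp
    moreover have "C1 (arc_in D' (i, cis t)) = C1 (arc_in D' (i, cis a)) \<longleftrightarrow>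
        C2 (arc_in D' (i, cis t)) = C2 (arc_in D' (i, cis a))"
      using D'.strand_colour[OF two_colouring_imp_alternating[OF D'.finite_flat C1(1)] s(1), of t]
        D'.strand_colour[OF two_colouring_imp_alternating[OF D'.finite_flat C2(1)] s(1), of t] s(2)
      by simp
    ultimately show ?thesis
      unfolding s(3) by (simp add: colour_same_iff)
  qed (use off x in simp)
  show ?thesis
  proof (rule PiE_ext)
    show "C1 \<in> arcs D' \<rightarrow>\<^sub>E UNIV" "C2 \<in> arcs D' \<rightarrow>\<^sub>E UNIV"
      using C1(1) C2(1) by (auto simp: two_colouring_def)
    \<comment> \<open>An arc is nonempty and is the incoming arc of each of its points, so equality
      of colours at points yields equality on arcs.\<close>
    fix a assume a: "a \<in> arcs D'"
    then obtain y where y: "y \<in> a" using arcs_nonempty by blast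
    then have "y \<in> circles D' - flat_points D'" using arcs_subset a by blast
    then show "C1 a = C2 a"
      using g[of y] arc_in_nonflat[OF D'.finite_flat] arc_at_eqI[OF a y] circles_eq by simp
  qed
qed

text \<open>The old colour function is kept outside and prescribed along each strand by counting the
  flat points of \<open>D'\<close>. The hypothesis on parities makes the prescribed colour fit the
  old one where the strand leaves the disc.\<close>

lemma transport_exists:
  assumes C: "two_colouring D C"
    and parity: "\<And>s. s \<in> set S \<Longrightarrow> even (card (strand_arc s \<inter> flat_points D)) \<longleftrightarrow>
        even (card (strand_arc s \<inter> flat_points D'))"
  obtains C' where "two_colouring D' C'" "agree_outside B (D, C) (D', C')"
proof -
  define g where "g x = C (arc_in D x)" for x
  have alt: "alternating D g"
    unfolding g_def by (rule two_colouring_imp_alternating[OF finite_flat C])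
  define P where "P x v \<longleftrightarrow> (x \<notin> left_inner \<longrightarrow> v = g x) \<and>
    (\<forall>i a b t. (i, a, b) \<in> set S \<and> t \<in> {a<..b} \<and> x = (i, cis t) \<longrightarrow>
      (v = g (i, cis a) \<longleftrightarrow> even (card (flat_params D' i a t))))" for x v
  have "\<exists>v. P x v" for x
  proof (cases "x \<in> left_inner")
    case True
    then obtain i a b t where s: "(i, a, b) \<in> set S" "t \<in> {a<..b}" "x = (i, cis t)"
      by (rule left_innerE)
    obtain w where w: "w \<noteq> g (i, cis a)"
      by (metis colour.distinct(1))
    \<comment> \<open>Strand coordinates are unique, so the universally quantified prescription in
      \<open>P\<close> imposes only one condition on the value at \<open>x\<close>.\<close>
    have "(i', a', b', t') = (i, a, b, t)"
      if s': "(i', a', b') \<in> set S" "t' \<in> {a'<..b'}" "x = (i', cis t')" for i' a' b' t'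
    proof -
      have "x \<in> strand_arc (i, a, b)"
        unfolding s(3) using s(2) by (intro strand_arcI) simp
      moreover have "x \<in> strand_arc (i', a', b')"
        unfolding s'(3) using s'(2) by (intro strand_arcI) simp
      ultimately have eq: "(i', a', b') = (i, a, b)"
        using strand_unique s(1) s'(1) by blast
      then have "t' = t"
        using strand_inj[OF s(1), of t' t] s(2,3) s'(2,3) by simp
      with eq show ?thesis by simp
    qed
    then have "P x (if even (card (flat_params D' i a t)) then g (i, cis a) else w)"
      using w True unfolding P_def by (auto split: if_splits)
    then show ?thesis ..
  next
    case False
    have "t \<notin> {a<..b}" if "(i, a, b) \<in> set S" "x = (i, cis t)" for i a b t
      using False that by (auto simp: left_inner_def)
    then have "P x (g x)"
      using False unfolding P_def by blast
    then show ?thesis ..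
  qed
  then obtain g' where g': "\<And>x. P x (g' x)" by metis
  have off: "g' x = g x" if "x \<notin> left_inner" for x
    using g'[of x] that unfolding P_def by blast
  have outside: "g' x = g x" if "x \<notin> (\<Union>s \<in> set S. strand_arc s)" for x
    using off[of x] left_inner_subset that by blast
  have inner: "g' (i, cis t) = g (i, cis a) \<longleftrightarrow> even (card (flat_params D' i a t))"
    if "(i, a, b) \<in> set S" "t \<in> {a<..b}" for i a b t
    using g'[of "(i, cis t)"] that unfolding P_def by blast
  have strand: "g' (i, cis t) = g (i, cis a) \<longleftrightarrow> even (card (flat_params D' i a t))"
    if "(i, a, b) \<in> set S" "t \<in> {a..b}" for i a b t
  proof (cases "t = a")
    case True
    then show ?thesis
      using off[OF start_notin_left_inner[OF that(1)]] by (simp add: flat_params_def)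
  next
    case False
    then show ?thesis using inner[OF that(1)] that(2) by simp
  qed
  have off_right: "g' x = g x" if "x \<notin> right_inner" for x
  proof (cases "x \<in> left_inner")
    case True
    then obtain i a b t where s: "(i, a, b) \<in> set S" "t \<in> {a<..b}" "x = (i, cis t)"
      by (rule left_innerE)
    then have tb: "t = b"
      using that by (force simp: right_inner_def order_le_less)
    \<comment> \<open>Here the parity hypothesis enters: along the whole strand both diagrams switch
      colour the same number of times modulo 2, so the colours at the far end agree.\<close>
    have "g' (i, cis b) = g (i, cis a) \<longleftrightarrow> g (i, cis b) = g (i, cis a)"
      using strand[OF s(1), of b] strand_colour[OF alt s(1), of b] strand_bounds[OF s(1)]
        parity[OF s(1)] card_flat_params[OF s(1)] D'.card_flat_params[OF s(1)] by auto
    then show ?thesis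
      unfolding s(3) tb by (simp add: colour_same_iff)
  qed (rule off)
  have flat_off_right: "x \<in> flat_points D' \<longleftrightarrow> x \<in> flat_points D"
    if x: "x \<in> circles D" "x \<notin> right_inner" for x
  proof (cases "x \<in> (\<Union>s \<in> set S. strand_arc s)")
    case True
    then obtain i a b t where s: "(i, a, b) \<in> set S" "t \<in> {a..b}" "x = (i, cis t)"
      by (auto elim: strand_arcE)
    then have "t = b"
      using x(2) by (force simp: right_inner_def order_le_less)
    then show ?thesis
      using endpoints_not_flat(2)[OF s(1)] D'.endpoints_not_flat(2)[OF s(1)] s(3) by simp
  qed (rule flat_iff_outside[OF x(1)])
  have small: "\<forall>\<^sub>F e::real in at_right 0. 0 < e \<and> e < d" if "d > 0" for d
    using that by (auto simp: eventually_at_right_field)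
  have "alternating D' g'"
    unfolding alternating_def circles_eq
  proof (intro ballI conjI)
    fix x assume x: "x \<in> circles D"
    note alt_x = bspec[OF alt[unfolded alternating_def] x]
    show "\<forall>\<^sub>F e in at_right 0. g' (rot x (- e)) = g' x"
    \<comment> \<open>Just before a point of \<open>left_inner\<close> the counting formula applies
      and the count is stable; just before any other point the old function is in force.\<close>
    proof (cases "x \<in> left_inner")
      case True
      then obtain i a b t where s: "(i, a, b) \<in> set S" "t \<in> {a<..b}" "x = (i, cis t)"
        by (rule left_innerE)
      have i: "i < ncomp D'" by (rule D'.strand_bounds(1)[OF s(1)])
      have "\<forall>\<^sub>F e in at_right 0. 0 < e \<and> e < t - a"
        using s by (intro small) auto
      then show ?thesis
        using eventually_flat_params_left[OF D'.finite_flat i, of a t]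
      proof eventually_elim
        case (elim e)
        then have "g' (i, cis (t - e)) = g (i, cis a) \<longleftrightarrow> g' (i, cis t) = g (i, cis a)"
          using strand[OF s(1), of "t - e"] strand[OF s(1), of t] s(2) by auto
        then show ?case
          by (simp add: s(3) colour_same_iff)
      qed
    next
      case False
      show ?thesis
        using eventually_outside(1)[OF x False] conjunct1[OF alt_x]
        by eventually_elim (metis outside off[OF False])
    qed
    show "\<forall>\<^sub>F e in at_right 0. g' (rot x e) = g' x \<longleftrightarrow> x \<notin> flat_points D'"
    \<comment> \<open>Just after a point of \<open>right_inner\<close> the count grows exactly at a
      flat point of \<open>D'\<close>. Elsewhere the behaviour is inherited from \<open>g\<close>,
      which by \<open>off_right\<close> also includes the far ends of strands.\<close>
    proof (cases "x \<in> right_inner")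
      case True
      then obtain i a b t where s: "(i, a, b) \<in> set S" "t \<in> {a..<b}" "x = (i, cis t)"
        by (rule right_innerE)
      have i: "i < ncomp D'" and at: "a \<le> t" and t: "t \<le> a + 2 * pi"
        using D'.strand_bounds[OF s(1)] s(2) by auto
      have "\<forall>\<^sub>F e in at_right 0. 0 < e \<and> e < b - t"
        using s by (intro small) auto
      then show ?thesis
        using eventually_flat_params_right[OF D'.finite_flat i at]
      proof eventually_elim
        case (elim e)
        have "g' (i, cis (t + e)) = g (i, cis a) \<longleftrightarrow> even (card (flat_params D' i a (t + e)))"
          "g' (i, cis t) = g (i, cis a) \<longleftrightarrow> even (card (flat_params D' i a t))"
          using strand[OF s(1), of "t + e"] strand[OF s(1), of t] s(2) elim by auto
        then have "(g' (i, cis (t + e)) = g (i, cis a) \<longleftrightarrow> g' (i, cis t) = g (i, cis a)) \<longleftrightarrow>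
            x \<notin> flat_points D'"
          using elim(2) even_card_flat_params_insert[OF D'.finite_flat t, of i]
          by (auto simp: s(3))
        then show ?case by (simp add: s(3) colour_same_iff)
      qed
    next
      case False
      show ?thesis
        using eventually_outside(2)[OF x False] conjunct2[OF alt_x]
        by eventually_elim (metis outside off_right[OF False] flat_off_right[OF x False])
    qed
  qed
  then obtain C' where C': "two_colouring D' C'"
    "\<And>x. x \<in> circles D' \<Longrightarrow> C' (arc_in D' x) = g' x"
    using alternating_imp_two_colouring[OF D'.finite_flat] by blast
  have "agree_outside B (D, C) (D', C')"
    unfolding agree_outside_def prod.case
  proof (intro ballI impI)
    fix x assume x: "x \<in> circles D - flat_points D" "curve D x \<notin> B"
    then have out: "x \<notin> (\<Union>s \<in> set S. strand_arc s)"
      using in_disc_iff by auto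
    then have "x \<in> circles D' - flat_points D'" "x \<notin> left_inner"
      using x flat_iff_outside circles_eq left_inner_subset by auto
    then show "C (arc_at D x) = C' (arc_at D' x)"
      using C'(2)[of x] off[of x] arc_in_nonflat[OF finite_flat x(1)]
        arc_in_nonflat[OF D'.finite_flat] by (simp add: g_def)
  qed
  with C'(1) that show ?thesis by blast
qed

end

lemma local_change_sym: "local_change B S D D' \<Longrightarrow> local_change B S D' D"
  by (auto simp: local_change_def circles_def)


section \<open>Parities of the crossings in a move\<close>

lemma colour_flip_both:
  fixes u u' v v' :: colour
  assumes "u \<noteq> u'" "v \<noteq> v'"
  shows "u = v \<longleftrightarrow> u' = v'"
  using assms by (cases u; cases u'; cases v; cases v') auto

text \<open>Each pair consists of the incoming colours at the two crossings of one strand of a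
  triangle. Going around the triangle meets three switches, so the third crossing is odd exactly
  when one of the other two is.\<close>

lemma colour_three_flips:
  fixes u u' v v' w w' :: colour
  assumes "u \<noteq> u'" "v \<noteq> v'" "w \<noteq> w'"
  shows "v' = w' \<longleftrightarrow> (u = v) \<noteq> (u' = w)"
  using assms by (cases u; cases u'; cases v; cases v'; cases w; cases w') auto

lemma colour_parity_pair:
  assumes "preim D c = {x, y}"
  shows "colour_parity D C c = (if C (arc_in D x) = C (arc_in D y) then 1 else 0)"
  using assms by (auto simp: colour_parity_def)

lemma crossesE:
  assumes "crosses D s s' p"
  obtains x y where "x \<in> strand_arc s" "y \<in> strand_arc s'" "x \<noteq> y" "preim D p = {x, y}"
    "curve D x = p" "curve D y = p"
proof -
  from assms obtain x y where xy: "x \<in> strand_arc s" "y \<in> strand_arc s'" "x \<noteq> y"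
    "preim D p = {x, y}"
    unfolding crosses_def by blast
  then have "x \<in> preim D p" "y \<in> preim D p" by auto
  then have "curve D x = p" "curve D y = p" by (simp_all add: preim_def)
  with xy that show ?thesis by blast
qed

section \<open>Flat points on the strands of each kind of move\<close>

context disc_diagram
begin

text \<open>A strand maps into \<open>B\<close>, so its flat points come from classical crossings in
  \<open>B\<close>. This reduces each move to its explicit list of crossings.\<close>

lemma strand_Int_flat:
  assumes "s \<in> set S"
  shows "strand_arc s \<inter> flat_points D =
    strand_arc s \<inter> (\<Union>p \<in> crossings D \<inter> B \<inter> classical D. preim D p)"
proof -
  have cl: "classical D \<subseteq> crossings D"
    using diagram by (simp add: virtual_link_diagram_def)
  have "x \<in> flat_points D \<longleftrightarrow> x \<in> (\<Union>p \<in> crossings D \<inter> B \<inter> classical D. preim D p)"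
    if x: "x \<in> strand_arc s" for x
  proof -
    have circ: "x \<in> circles D" using x strand_arc_subset[OF assms] by blast
    then have "curve D x \<in> B" using in_disc_iff x assms by blast
    with circ show ?thesis using cl by (auto simp: flat_points_def preim_def)
  qed
  then show ?thesis by blast
qed

lemma kink_flats:
  assumes "S = [s]" "crossings D \<inter> B = {c}" "crosses D s s c" "c \<in> classical D"
  obtains x y where "x \<noteq> y" "preim D c = {x, y}" "strand_arc s \<inter> flat_points D = {x, y}"
proof -
  obtain x y where xy: "x \<in> strand_arc s" "y \<in> strand_arc s" "x \<noteq> y" "preim D c = {x, y}"
    using assms(3) by (rule crossesE)
  moreover have "strand_arc s \<inter> flat_points D = {x, y}"
    using strand_Int_flat[of s] assms xy by auto
  ultimately show ?thesis using that by blast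
qed

lemma bigon_flats:
  assumes S: "S = [s, s']" and c: "c1 \<noteq> c2" "crossings D \<inter> B = {c1, c2}"
    and cr: "crosses D s s' c1" "crosses D s s' c2"
    and cl: "c1 \<in> classical D" "c2 \<in> classical D"
  obtains x1 y1 x2 y2 where "preim D c1 = {x1, y1}" "preim D c2 = {x2, y2}" "x1 \<noteq> x2" "y1 \<noteq> y2"
    "strand_arc s \<inter> flat_points D = {x1, x2}" "strand_arc s' \<inter> flat_points D = {y1, y2}"
proof -
  obtain x1 y1 where 1: "x1 \<in> strand_arc s" "y1 \<in> strand_arc s'" "preim D c1 = {x1, y1}"
    "curve D x1 = c1" "curve D y1 = c1"
    using cr(1) by (rule crossesE)
  obtain x2 y2 where 2: "x2 \<in> strand_arc s" "y2 \<in> strand_arc s'" "preim D c2 = {x2, y2}"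
    "curve D x2 = c2" "curve D y2 = c2"
    using cr(2) by (rule crossesE)
  have disj: "strand_arc s \<inter> strand_arc s' = {}"
    using strands_disjoint[of 0 1] S by simp
  have fl: "(\<Union>p \<in> crossings D \<inter> B \<inter> classical D. preim D p) = {x1, y1, x2, y2}"
    using c(2) cl 1(3) 2(3) by auto
  have notin: "y1 \<notin> strand_arc s" "y2 \<notin> strand_arc s" "x1 \<notin> strand_arc s'" "x2 \<notin> strand_arc s'"
    using disj 1(1,2) 2(1,2) by blast+
  have "strand_arc s \<inter> flat_points D = {x1, x2}"
    using strand_Int_flat[of s] S notin(1,2) 1(1) 2(1) unfolding fl by auto
  moreover have "strand_arc s' \<inter> flat_points D = {y1, y2}"
    using strand_Int_flat[of s'] S notin(3,4) 1(2) 2(2) unfolding fl by auto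
  moreover have "x1 \<noteq> x2" "y1 \<noteq> y2" using 1(4,5) 2(4,5) c(1) by auto
  ultimately show ?thesis using that 1(3) 2(3) by blast
qed

text \<open>In the names, \<open>x12\<close> is the preimage of \<open>c12\<close> on the first
  strand and \<open>x21\<close> the one on the second, and similarly for the others. Leaving
  classicality as a filter lets classical and mixed triangles share this analysis.\<close>

lemma triangle_flats:
  assumes S: "S = [s1, s2, s3]" and tri: "triangle B D s1 s2 s3 c12 c13 c23"
  obtains x12 x21 x13 x31 x23 x32 where
    "preim D c12 = {x12, x21}" "preim D c13 = {x13, x31}" "preim D c23 = {x23, x32}"
    "curve D x12 = c12" "curve D x21 = c12" "curve D x13 = c13" "curve D x31 = c13"
    "curve D x23 = c23" "curve D x32 = c23"
    "c12 \<noteq> c13" "c12 \<noteq> c23" "c13 \<noteq> c23"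
    "strand_arc s1 \<inter> flat_points D = {x \<in> {x12, x13}. curve D x \<in> classical D}"
    "strand_arc s2 \<inter> flat_points D = {x \<in> {x21, x23}. curve D x \<in> classical D}"
    "strand_arc s3 \<inter> flat_points D = {x \<in> {x31, x32}. curve D x \<in> classical D}"
proof -
  have c: "crossings D \<inter> B = {c12, c13, c23}"
    and cr: "crosses D s1 s2 c12" "crosses D s1 s3 c13" "crosses D s2 s3 c23"
    using tri by (simp_all add: triangle_def)
  obtain x12 x21 where 1: "x12 \<in> strand_arc s1" "x21 \<in> strand_arc s2" "x12 \<noteq> x21"
    "preim D c12 = {x12, x21}" "curve D x12 = c12" "curve D x21 = c12"
    using cr(1) by (rule crossesE)
  obtain x13 x31 where 2: "x13 \<in> strand_arc s1" "x31 \<in> strand_arc s3" "x13 \<noteq> x31"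
    "preim D c13 = {x13, x31}" "curve D x13 = c13" "curve D x31 = c13"
    using cr(2) by (rule crossesE)
  obtain x23 x32 where 3: "x23 \<in> strand_arc s2" "x32 \<in> strand_arc s3" "x23 \<noteq> x32"
    "preim D c23 = {x23, x32}" "curve D x23 = c23" "curve D x32 = c23"
    using cr(3) by (rule crossesE)
  have disj: "strand_arc s1 \<inter> strand_arc s2 = {}" "strand_arc s1 \<inter> strand_arc s3 = {}"
    "strand_arc s2 \<inter> strand_arc s3 = {}"
    using strands_disjoint[of 0 1] strands_disjoint[of 0 2] strands_disjoint[of 1 2] S by simp_all
  \<comment> \<open>Preimages of different crossings lie on different pairs of disjoint strands,
    which makes the three crossings distinct.\<close>
  have "x21 \<notin> preim D c13" "x12 \<notin> preim D c23" "x13 \<notin> preim D c23"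
    using disj 1(1,2) 2(1,2) 3(1,2) unfolding 2(4) 3(4) by auto
  then have neq: "c12 \<noteq> c13" "c12 \<noteq> c23" "c13 \<noteq> c23"
    using 1(4) 2(4) by auto
  have notin: "x21 \<notin> strand_arc s1" "x23 \<notin> strand_arc s1"
    "x31 \<notin> strand_arc s1" "x32 \<notin> strand_arc s1"
    "x12 \<notin> strand_arc s2" "x13 \<notin> strand_arc s2" "x31 \<notin> strand_arc s2" "x32 \<notin> strand_arc s2"
    "x12 \<notin> strand_arc s3" "x13 \<notin> strand_arc s3" "x21 \<notin> strand_arc s3" "x23 \<notin> strand_arc s3"
    using disj 1(1,2) 2(1,2) 3(1,2) by blast+
  have "(\<Union>p \<in> crossings D \<inter> B \<inter> classical D. preim D p) =
      {x \<in> preim D c12 \<union> preim D c13 \<union> preim D c23. curve D x \<in> classical D}"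
    unfolding c by (auto simp: preim_def)
  then have fl: "strand_arc s \<inter> flat_points D =
      strand_arc s \<inter> {x \<in> {x12, x21, x13, x31, x23, x32}. curve D x \<in> classical D}"
    if "s \<in> {s1, s2, s3}" for s
    using strand_Int_flat[of s] that S unfolding 1(4) 2(4) 3(4) by auto
  have "strand_arc s1 \<inter> flat_points D = {x \<in> {x12, x13}. curve D x \<in> classical D}"
    using fl[of s1] notin(1-4) 1(1) 2(1) by auto
  moreover have "strand_arc s2 \<inter> flat_points D = {x \<in> {x21, x23}. curve D x \<in> classical D}"
    using fl[of s2] notin(5-8) 1(2) 3(1) by auto
  moreover have "strand_arc s3 \<inter> flat_points D = {x \<in> {x31, x32}. curve D x \<in> classical D}"
    using fl[of s3] notin(9-12) 2(2) 3(2) by auto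
  ultimately show ?thesis
    using that[of x12 x21 x13 x31 x23 x32] 1(4-6) 2(4-6) 3(4-6) neq by blast
qed

lemma triangle_classical_flats:
  assumes S: "S = [s1, s2, s3]" and tri: "triangle B D s1 s2 s3 c12 c13 c23"
    and cl: "{c12, c13, c23} \<subseteq> classical D"
  obtains x12 x21 x13 x31 x23 x32 where
    "preim D c12 = {x12, x21}" "preim D c13 = {x13, x31}" "preim D c23 = {x23, x32}"
    "curve D x12 = c12" "curve D x21 = c12" "curve D x13 = c13" "curve D x31 = c13"
    "curve D x23 = c23" "curve D x32 = c23"
    "c12 \<noteq> c13" "c12 \<noteq> c23" "c13 \<noteq> c23"
    "strand_arc s1 \<inter> flat_points D = {x12, x13}"
    "strand_arc s2 \<inter> flat_points D = {x21, x23}"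
    "strand_arc s3 \<inter> flat_points D = {x31, x32}"
proof (rule triangle_flats[OF S tri])
  note result = that
  have filter_pair: "{x \<in> {u, v}. P x} = {u, v}" if "P u" "P v" for P and u v :: circle_point
    using that by auto
  show thesis if x: "preim D c12 = {x12, x21}" "preim D c13 = {x13, x31}" "preim D c23 = {x23, x32}"
    "curve D x12 = c12" "curve D x21 = c12" "curve D x13 = c13" "curve D x31 = c13"
    "curve D x23 = c23" "curve D x32 = c23"
    "c12 \<noteq> c13" "c12 \<noteq> c23" "c13 \<noteq> c23"
    "strand_arc s1 \<inter> flat_points D = {x \<in> {x12, x13}. curve D x \<in> classical D}"
    "strand_arc s2 \<inter> flat_points D = {x \<in> {x21, x23}. curve D x \<in> classical D}"
    "strand_arc s3 \<inter> flat_points D = {x \<in> {x31, x32}. curve D x \<in> classical D}"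
    for x12 x21 x13 x31 x23 x32
  proof -
    have "{x \<in> {x12, x13}. curve D x \<in> classical D} = {x12, x13}"
      "{x \<in> {x21, x23}. curve D x \<in> classical D} = {x21, x23}"
      "{x \<in> {x31, x32}. curve D x \<in> classical D} = {x31, x32}"
      using cl by (auto simp only: x(4-9) intro!: filter_pair)
    with x(13-15) show thesis
      by (intro result[OF x(1-12)]) (simp_all only:)
  qed
qed

end

text \<open>The two preimages of the crossing are the only flat points on one strand, so exactly one
  switch separates their incoming colours.\<close>

lemma colour_parity_kink:
  assumes "local_change B [s] D D'" "crossings D \<inter> B = {c}" "crosses D s s c" "c \<in> classical D"
    and C: "two_colouring D C"
  shows "colour_parity D C c = 0"
proof -
  interpret local_move B "[s]" D D' by unfold_locales fact
  obtain x y where "x \<noteq> y" "preim D c = {x, y}" "strand_arc s \<inter> flat_points D = {x, y}"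
    by (rule kink_flats[OF refl assms(2-4)])
  then show ?thesis
    using two_flats(1)[OF two_colouring_imp_alternating[OF finite_flat C], of s x y]
    by (simp add: colour_parity_pair)
qed

text \<open>Passing from one crossing to the other switches the incoming colour on both strands, and
  two switches preserve whether the colours are equal.\<close>

lemma colour_parity_bigon:
  assumes bigon: "bigon B D D' s s' c1 c2" and cl: "c1 \<in> classical D" "c2 \<in> classical D"
    and C: "two_colouring D C"
  shows "colour_parity D C c1 = colour_parity D C c2"
proof -
  interpret local_move B "[s, s']" D D'
    using bigon by unfold_locales (simp add: bigon_def)
  note alt = two_colouring_imp_alternating[OF finite_flat C]
  have b: "c1 \<noteq> c2" "crossings D \<inter> B = {c1, c2}" "crosses D s s' c1" "crosses D s s' c2"
    using bigon by (simp_all add: bigon_def)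
  obtain x1 y1 x2 y2 where p: "preim D c1 = {x1, y1}" "preim D c2 = {x2, y2}"
    and neq: "x1 \<noteq> x2" "y1 \<noteq> y2"
    and fl: "strand_arc s \<inter> flat_points D = {x1, x2}" "strand_arc s' \<inter> flat_points D = {y1, y2}"
    by (rule bigon_flats[OF refl b cl])
  have flip: "C (arc_in D x1) \<noteq> C (arc_in D x2)" "C (arc_in D y1) \<noteq> C (arc_in D y2)"
    using two_flats(1)[OF alt _ fl(1) neq(1)] two_flats(1)[OF alt _ fl(2) neq(2)] by auto
  show ?thesis
    by (simp only: p[THEN colour_parity_pair] colour_flip_both[OF flip])
qed

lemma even_card_filter_three:
  assumes "a \<noteq> b" "a \<noteq> c" "b \<noteq> c" and "P c \<longleftrightarrow> (P a \<noteq> P b)"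
  shows "card {x \<in> {a, b, c}. P x} \<in> {3, 0, 2}" "\<not> (P a \<and> P b \<and> P c)"
proof -
  have "{x \<in> {a, b, c}. P x} =
    (if P a then {a} else {}) \<union> (if P b then {b} else {}) \<union> (if P c then {c} else {})"
    by auto
  then show "card {x \<in> {a, b, c}. P x} \<in> {3, 0, 2}"
    using assms by auto
  show "\<not> (P a \<and> P b \<and> P c)" using assms by blast
qed

text \<open>Within \<open>D\<close> the three switches along the strands relate the three parities.
  Between \<open>D\<close> and \<open>D'\<close>, the reversed order on a strand switches the
  incoming colour at each of its crossings; every crossing lies on two strands, so its parity
  survives.\<close>

lemma colour_parity_triangle:
  assumes move: "triangle_move B D D' s1 s2 s3 c12 c13 c23 d12 d13 d23"
    and cl: "{c12, c13, c23} \<subseteq> classical D" "{d12, d13, d23} \<subseteq> classical D'"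
    and C: "two_colouring D C" "two_colouring D' C'" "agree_outside B (D, C) (D', C')"
  shows "c12 \<noteq> c13" "c12 \<noteq> c23" "c13 \<noteq> c23"
    and "colour_parity D C c23 = 1 \<longleftrightarrow> colour_parity D C c12 \<noteq> colour_parity D C c13"
    and "colour_parity D C c12 = colour_parity D' C' d12"
    and "colour_parity D C c13 = colour_parity D' C' d13"
    and "colour_parity D C c23 = colour_parity D' C' d23"
proof -
  interpret local_move B "[s1, s2, s3]" D D'
    using move by unfold_locales (simp add: triangle_move_def)
  note alt = two_colouring_imp_alternating[OF finite_flat C(1)]
  note alt' = two_colouring_imp_alternating[OF D'.finite_flat C(2)]
  have tri: "triangle B D s1 s2 s3 c12 c13 c23" "triangle B D' s1 s2 s3 d12 d13 d23"
    and bef: "before D s1 c12 c13 \<longleftrightarrow> before D' s1 d13 d12"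
      "before D s2 c12 c23 \<longleftrightarrow> before D' s2 d23 d12"
      "before D s3 c13 c23 \<longleftrightarrow> before D' s3 d23 d13"
    using move by (simp_all add: triangle_move_def)
  obtain x12 x21 x13 x31 x23 x32 where x:
    "preim D c12 = {x12, x21}" "preim D c13 = {x13, x31}" "preim D c23 = {x23, x32}"
    "curve D x12 = c12" "curve D x21 = c12" "curve D x13 = c13" "curve D x31 = c13"
    "curve D x23 = c23" "curve D x32 = c23"
    "c12 \<noteq> c13" "c12 \<noteq> c23" "c13 \<noteq> c23"
    "strand_arc s1 \<inter> flat_points D = {x12, x13}"
    "strand_arc s2 \<inter> flat_points D = {x21, x23}"
    "strand_arc s3 \<inter> flat_points D = {x31, x32}"
    by (rule triangle_classical_flats[OF refl tri(1) cl(1)])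
  obtain y12 y21 y13 y31 y23 y32 where y:
    "preim D' d12 = {y12, y21}" "preim D' d13 = {y13, y31}" "preim D' d23 = {y23, y32}"
    "curve D' y12 = d12" "curve D' y21 = d12" "curve D' y13 = d13" "curve D' y31 = d13"
    "curve D' y23 = d23" "curve D' y32 = d23"
    "d12 \<noteq> d13" "d12 \<noteq> d23" "d13 \<noteq> d23"
    "strand_arc s1 \<inter> flat_points D' = {y12, y13}"
    "strand_arc s2 \<inter> flat_points D' = {y21, y23}"
    "strand_arc s3 \<inter> flat_points D' = {y31, y32}"
    by (rule D'.triangle_classical_flats[OF refl tri(2) cl(2)])
  have flip: "C (arc_in D u) \<noteq> C (arc_in D v) \<and>
      C (arc_in D u) \<noteq> C' (arc_in D' u') \<and> C (arc_in D v) \<noteq> C' (arc_in D' v')"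
    if s: "s \<in> set [s1, s2, s3]"
      and uv: "strand_arc s \<inter> flat_points D = {u, v}" "curve D u \<noteq> curve D v"
      and uv': "strand_arc s \<inter> flat_points D' = {u', v'}" "curve D' u' \<noteq> curve D' v'"
      and b: "before D s (curve D u) (curve D v) \<longleftrightarrow> before D' s (curve D' v') (curve D' u')"
    for s u v u' v'
  proof -
    have fl: "strand_arc s \<inter> flat_points D' = {v', u'}" using uv'(1) by (simp add: insert_commute)
    have neq: "u \<noteq> v" "v' \<noteq> u'" using uv(2) uv'(2) by auto
    have ne: "C (arc_in D u) \<noteq> C (arc_in D v)" "C' (arc_in D' v') \<noteq> C' (arc_in D' u')"
      using two_flats(1)[OF alt s uv(1) neq(1)] D'.two_flats(1)[OF alt' s fl neq(2)] by auto
    have "C (arc_in D u) = C (arc_in D (start s)) \<longleftrightarrow>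
        C' (arc_in D' v') = C' (arc_in D' (start s))"
      using two_flats(2)[OF alt s uv(1) neq(1) uv(2)]
        D'.two_flats(2)[OF alt' s fl neq(2) uv'(2)[symmetric]] b by simp
    \<comment> \<open>By the order reversal \<open>u\<close> and \<open>v'\<close> are both first or
      both second on the strand, and its start colour is the same in both diagrams.\<close>
    then have "C (arc_in D u) = C' (arc_in D' v')"
      using start_colour_agree[OF C s] by (simp add: colour_same_iff)
    with ne show ?thesis by metis
  qed
  have f1: "C (arc_in D x12) \<noteq> C (arc_in D x13)" "C (arc_in D x12) \<noteq> C' (arc_in D' y12)"
      "C (arc_in D x13) \<noteq> C' (arc_in D' y13)"
    using flip[OF _ x(13) _ y(13)] x(4-12) y(4-12) bef(1) by simp_all
  have f2: "C (arc_in D x21) \<noteq> C (arc_in D x23)" "C (arc_in D x21) \<noteq> C' (arc_in D' y21)"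
      "C (arc_in D x23) \<noteq> C' (arc_in D' y23)"
    using flip[OF _ x(14) _ y(14)] x(4-12) y(4-12) bef(2) by simp_all
  have f3: "C (arc_in D x31) \<noteq> C (arc_in D x32)" "C (arc_in D x31) \<noteq> C' (arc_in D' y31)"
      "C (arc_in D x32) \<noteq> C' (arc_in D' y32)"
    using flip[OF _ x(15) _ y(15)] x(4-12) y(4-12) bef(3) by simp_all
  note par = x(1-3)[THEN colour_parity_pair] y(1-3)[THEN colour_parity_pair]
  have bits: "(if P then 1 else 0) = (1 :: bit) \<longleftrightarrow> P"
    "(if P then 1 else 0) \<noteq> (if Q then 1 else 0 :: bit) \<longleftrightarrow> P \<noteq> Q" for P Q
    by auto
  show "c12 \<noteq> c13" "c12 \<noteq> c23" "c13 \<noteq> c23" by fact+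
  show "colour_parity D C c23 = 1 \<longleftrightarrow> colour_parity D C c12 \<noteq> colour_parity D C c13"
    unfolding par bits by (rule colour_three_flips[OF f1(1) f2(1) f3(1)])
  show "colour_parity D C c12 = colour_parity D' C' d12"
    by (simp only: par colour_flip_both[OF f1(2) f2(2)])
  show "colour_parity D C c13 = colour_parity D' C' d13"
    by (simp only: par colour_flip_both[OF f1(3) f3(2)])
  show "colour_parity D C c23 = colour_parity D' C' d23"
    by (simp only: par colour_flip_both[OF f2(3) f3(3)])
qed

lemma mixed_flats:
  assumes "disc_diagram B [s1, s2, s3] D" and tri: "triangle B D s1 s2 s3 c v1 v2"
    and cl: "{c, v1, v2} \<inter> classical D = {c}"
  obtains x y where "preim D c = {x, y}" "strand_arc s1 \<inter> flat_points D = {x}"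
    "strand_arc s2 \<inter> flat_points D = {y}" "strand_arc s3 \<inter> flat_points D = {}"
proof -
  interpret disc_diagram B "[s1, s2, s3]" D by fact
  obtain x12 x21 x13 x31 x23 x32 where x:
    "preim D c = {x12, x21}"
    "curve D x12 = c" "curve D x21 = c" "curve D x13 = v1" "curve D x31 = v1"
    "curve D x23 = v2" "curve D x32 = v2" "c \<noteq> v1" "c \<noteq> v2"
    "strand_arc s1 \<inter> flat_points D = {x \<in> {x12, x13}. curve D x \<in> classical D}"
    "strand_arc s2 \<inter> flat_points D = {x \<in> {x21, x23}. curve D x \<in> classical D}"
    "strand_arc s3 \<inter> flat_points D = {x \<in> {x31, x32}. curve D x \<in> classical D}"
    by (rule triangle_flats[OF refl tri]) blast
  have "v \<notin> classical D" if "v \<in> {v1, v2}" for v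
  proof
    assume "v \<in> classical D"
    with that have "v \<in> {c, v1, v2} \<inter> classical D" by blast
    with cl x(8,9) that show False by auto
  qed
  moreover have "c \<in> classical D" using cl by blast
  ultimately have "c \<in> classical D" "v1 \<notin> classical D" "v2 \<notin> classical D"
    by blast+
  then have "strand_arc s1 \<inter> flat_points D = {x12}"
    "strand_arc s2 \<inter> flat_points D = {x21}" "strand_arc s3 \<inter> flat_points D = {}"
    unfolding x(10-12) using x(2-7) by auto
  with x(1) that show ?thesis by blast
qed

text \<open>Each of the two strands through the classical crossing carries just one flat point on
  either side of the move, so its incoming colour is the common start colour.\<close>

lemma colour_parity_mixed:
  assumes "mixed_move B D D' c d"
    and C: "two_colouring D C" "two_colouring D' C'" "agree_outside B (D, C) (D', C')"
  shows "colour_parity D C c = colour_parity D' C' d"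
proof -
  obtain s1 s2 s3 v1 v2 w1 w2 where
    move: "triangle_move B D D' s1 s2 s3 c v1 v2 d w1 w2"
    and cl: "{c, v1, v2} \<inter> classical D = {c}" "{d, w1, w2} \<inter> classical D' = {d}"
    using assms(1) unfolding mixed_move_def by blast
  then have tri: "triangle B D s1 s2 s3 c v1 v2" "triangle B D' s1 s2 s3 d w1 w2"
    by (simp_all add: triangle_move_def)
  interpret local_move B "[s1, s2, s3]" D D'
    using move by unfold_locales (simp add: triangle_move_def)
  note alt = two_colouring_imp_alternating[OF finite_flat C(1)]
  note alt' = two_colouring_imp_alternating[OF D'.finite_flat C(2)]
  obtain x y where x: "preim D c = {x, y}" "strand_arc s1 \<inter> flat_points D = {x}"
    "strand_arc s2 \<inter> flat_points D = {y}"
    by (rule mixed_flats[OF disc_diagram_axioms tri(1) cl(1)])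
  obtain x' y' where y: "preim D' d = {x', y'}" "strand_arc s1 \<inter> flat_points D' = {x'}"
    "strand_arc s2 \<inter> flat_points D' = {y'}"
    by (rule mixed_flats[OF D'.disc_diagram_axioms tri(2) cl(2)])
  have "C (arc_in D x) = C' (arc_in D' x')"
    using one_flat[OF alt _ x(2)] D'.one_flat[OF alt' _ y(2)] start_colour_agree[OF C] by simp
  moreover have "C (arc_in D y) = C' (arc_in D' y')"
    using one_flat[OF alt _ x(3)] D'.one_flat[OF alt' _ y(3)] start_colour_agree[OF C] by simp
  ultimately show ?thesis
    by (simp add: x(1) y(1) colour_parity_pair)
qed

text \<open>All preimages of \<open>c\<close> lie off the strands, where the two curves coincide and
  the incoming colours agree.\<close>

lemma colour_parity_outside:
  assumes change: "local_change B S D D'"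
    and C: "two_colouring D C" "two_colouring D' C'" "agree_outside B (D, C) (D', C')"
    and c: "c \<notin> B"
  shows "colour_parity D C c = colour_parity D' C' c"
proof -
  interpret local_move B S D D' by unfold_locales fact
  have out: "x \<in> circles D \<and> x \<notin> (\<Union>s \<in> set S. strand_arc s)"
    if "x \<in> preim D c \<or> x \<in> preim D' c" for x
    using that c in_disc_iff[of x] D'.in_disc_iff[of x] circles_eq
    by (auto simp: preim_def)
  then have "x \<in> preim D c \<longleftrightarrow> x \<in> preim D' c" for x
    using curve_eq_outside[of x] unfolding preim_def circles_eq mem_Collect_eq by metis
  then have "preim D c = preim D' c" by blast
  moreover have "C (arc_in D x) = C' (arc_in D' x)" if "x \<in> preim D c" for x
    using out[of x] that left_inner_subset by (intro left_colour_agree[OF C]) auto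
  ultimately show ?thesis by (simp add: colour_parity_def)
qed

section \<open>Existence of transport for every move, and the parity axioms\<close>

lemma elementary_move_strands:
  assumes "elementary_move B D D'"
  obtains S where "local_change B S D D'"
    "\<And>s. s \<in> set S \<Longrightarrow> even (card (strand_arc s \<inter> flat_points D)) \<longleftrightarrow>
        even (card (strand_arc s \<inter> flat_points D'))"
proof -
  note result = that
  have empty: "strand_arc s \<inter> flat_points E = {}"
    if "disc_diagram B S E" "s \<in> set S" "crossings E \<inter> B \<inter> classical E = {}" for S E s
    using disc_diagram.strand_Int_flat[OF that(1,2)] that(3) by simp
  have kink: thesis if k: "kink B D D' c" for c
  proof -
    obtain s where s: "local_change B [s] D D'" "crossings D \<inter> B = {c}" "crosses D s s c"
      "crossings D' \<inter> B = {}"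
      using k unfolding kink_def by blast
    interpret local_move B "[s]" D D' by unfold_locales (rule s)
    have "even (card (strand_arc s \<inter> flat_points D))"
    proof (cases "c \<in> classical D")
      case True
      obtain x y where "x \<noteq> y" "preim D c = {x, y}" "strand_arc s \<inter> flat_points D = {x, y}"
        by (rule kink_flats[OF refl s(2,3) True])
      then show ?thesis by simp
    next
      case False
      then show ?thesis using empty[OF disc_diagram_axioms] s(2) by simp
    qed
    moreover have "strand_arc s \<inter> flat_points D' = {}"
      using empty[OF D'.disc_diagram_axioms] s(4) by simp
    ultimately show thesis using result[OF s(1)] by simp
  qed
  have bigon: thesis if k: "bigon B D D' s s' c1 c2"
    and cl: "c1 \<in> classical D \<longleftrightarrow> c2 \<in> classical D" for s s' c1 c2
  proof -
    have s: "local_change B [s, s'] D D'" "c1 \<noteq> c2" "crossings D \<inter> B = {c1, c2}"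
      "crosses D s s' c1" "crosses D s s' c2" "crossings D' \<inter> B = {}"
      using k by (simp_all add: bigon_def)
    interpret local_move B "[s, s']" D D' by unfold_locales (rule s)
    have "even (card (strand_arc s \<inter> flat_points D)) \<and> even (card (strand_arc s' \<inter> flat_points D))"
    proof (cases "c1 \<in> classical D")
      case True
      then have "c2 \<in> classical D" using cl by simp
      obtain x1 y1 x2 y2 where "preim D c1 = {x1, y1}" "preim D c2 = {x2, y2}"
        "x1 \<noteq> x2" "y1 \<noteq> y2"
        "strand_arc s \<inter> flat_points D = {x1, x2}" "strand_arc s' \<inter> flat_points D = {y1, y2}"
        by (rule bigon_flats[OF refl s(2-5) True \<open>c2 \<in> classical D\<close>])
      then show ?thesis by simp
    next
      case False
      then show ?thesis using empty[OF disc_diagram_axioms] s(3) cl by simp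
    qed
    moreover have "strand_arc s \<inter> flat_points D' = {}" "strand_arc s' \<inter> flat_points D' = {}"
      using empty[OF D'.disc_diagram_axioms] s(6) by simp_all
    ultimately have "even (card (strand_arc t \<inter> flat_points D)) \<longleftrightarrow>
        even (card (strand_arc t \<inter> flat_points D'))" if "t \<in> {s, s'}" for t
      using that by auto
    then show thesis using result[OF s(1)] by simp
  qed
  \<comment> \<open>For a triangle the counts on each strand are equal, not merely congruent: two on
    every strand if all crossings are classical, none if all are virtual, and 1, 1, 0 for a mixed
    move.\<close>
  have tri: thesis if k: "triangle_move B D D' s1 s2 s3 c1 c2 c3 d1 d2 d3"
    and cl: "{c1, c2, c3} \<subseteq> classical D \<and> {d1, d2, d3} \<subseteq> classical D' \<or>
      {c1, c2, c3} \<inter> classical D = {} \<and> {d1, d2, d3} \<inter> classical D' = {} \<or>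
      {c1, c2, c3} \<inter> classical D = {c1} \<and> {d1, d2, d3} \<inter> classical D' = {d1}"
    for s1 s2 s3 c1 c2 c3 d1 d2 d3
  proof -
    have s: "local_change B [s1, s2, s3] D D'" "triangle B D s1 s2 s3 c1 c2 c3"
      "triangle B D' s1 s2 s3 d1 d2 d3"
      using k by (simp_all add: triangle_move_def)
    interpret local_move B "[s1, s2, s3]" D D' by unfold_locales (rule s)
    have two: "card (strand_arc s \<inter> flat_points E) = 2"
      if E: "disc_diagram B [s1, s2, s3] E" "triangle B E s1 s2 s3 e1 e2 e3"
        "{e1, e2, e3} \<subseteq> classical E" and st: "s \<in> {s1, s2, s3}" for E e1 e2 e3 s
    proof -
      obtain x12 x21 x13 x31 x23 x32 where x:
        "preim E e1 = {x12, x21}" "preim E e2 = {x13, x31}" "preim E e3 = {x23, x32}"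
        "curve E x12 = e1" "curve E x21 = e1" "curve E x13 = e2" "curve E x31 = e2"
        "curve E x23 = e3" "curve E x32 = e3" "e1 \<noteq> e2" "e1 \<noteq> e3" "e2 \<noteq> e3"
        "strand_arc s1 \<inter> flat_points E = {x12, x13}"
        "strand_arc s2 \<inter> flat_points E = {x21, x23}"
        "strand_arc s3 \<inter> flat_points E = {x31, x32}"
        by (rule disc_diagram.triangle_classical_flats[OF E(1) refl E(2,3)])
      have "x12 \<noteq> x13" "x21 \<noteq> x23" "x31 \<noteq> x32" using x(4-12) by auto
      with st x(13-15) show ?thesis by auto
    qed
    have crossings: "crossings D \<inter> B = {c1, c2, c3}" "crossings D' \<inter> B = {d1, d2, d3}"
      using s(2,3) by (simp_all add: triangle_def)
    have "card (strand_arc s \<inter> flat_points D) = card (strand_arc s \<inter> flat_points D')"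
      if st: "s \<in> {s1, s2, s3}" for s
      using cl
    proof (elim disjE conjE)
      assume "{c1, c2, c3} \<subseteq> classical D" "{d1, d2, d3} \<subseteq> classical D'"
      then show ?thesis
        using two[OF disc_diagram_axioms s(2) _ st] two[OF D'.disc_diagram_axioms s(3) _ st] by simp
    next
      assume "{c1, c2, c3} \<inter> classical D = {}" "{d1, d2, d3} \<inter> classical D' = {}"
      then show ?thesis
        using empty[OF disc_diagram_axioms, of s] empty[OF D'.disc_diagram_axioms, of s] st
          crossings by simp
    next
      assume c: "{c1, c2, c3} \<inter> classical D = {c1}" and d: "{d1, d2, d3} \<inter> classical D' = {d1}"
      obtain x y where "strand_arc s1 \<inter> flat_points D = {x}"
        "strand_arc s2 \<inter> flat_points D = {y}" "strand_arc s3 \<inter> flat_points D = {}"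
        by (rule mixed_flats[OF disc_diagram_axioms s(2) c])
      moreover obtain x' y' where "strand_arc s1 \<inter> flat_points D' = {x'}"
        "strand_arc s2 \<inter> flat_points D' = {y'}" "strand_arc s3 \<inter> flat_points D' = {}"
        by (rule mixed_flats[OF D'.disc_diagram_axioms s(3) d])
      ultimately show ?thesis using st by auto
    qed
    then show thesis using result[OF s(1)] by simp
  qed
  from assms show thesis
    unfolding elementary_move_def virtual3_def mixed_move_def
  proof (elim disjE exE conjE)
    fix c assume "reidemeister1 B D D' c"
    then show thesis using kink unfolding reidemeister1_def by blast
  next
    fix c1 c2 assume "reidemeister2 B D D' c1 c2"
    then show thesis using bigon unfolding reidemeister2_def by blast
  next
    fix c1 c2 c3 d1 d2 d3 assume "reidemeister3 B D D' c1 c2 c3 d1 d2 d3"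
    then obtain s1 s2 s3 where "triangle_move B D D' s1 s2 s3 c1 c2 c3 d1 d2 d3"
      "{c1, c2, c3} \<subseteq> classical D" "{d1, d2, d3} \<subseteq> classical D'"
      unfolding reidemeister3_def by blast
    then show thesis by (intro tri) (assumption, intro disjI1 conjI)
  next
    assume "virtual1 B D D'"
    then show thesis using kink unfolding virtual1_def by blast
  next
    assume "virtual2 B D D'"
    then show thesis unfolding virtual2_def by (auto intro: bigon)
  next
    fix s1 s2 s3 c1 c2 c3 d1 d2 d3
    assume "triangle_move B D D' s1 s2 s3 c1 c2 c3 d1 d2 d3"
      "{c1, c2, c3} \<inter> classical D = {}" "{d1, d2, d3} \<inter> classical D' = {}"
    then show thesis by (intro tri) (assumption, intro disjI2 disjI1 conjI)
  next
    fix c d s1 s2 s3 v1 v2 w1 w2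
    assume "triangle_move B D D' s1 s2 s3 c v1 v2 d w1 w2"
      "{c, v1, v2} \<inter> classical D = {c}" "{d, w1, w2} \<inter> classical D' = {d}"
    then show thesis by (intro tri) (assumption, intro disjI2 conjI)
  qed
qed

lemma reidemeister_move_strands:
  assumes "reidemeister_move B D D'"
  obtains S where "local_change B S D D'"
    "\<And>s. s \<in> set S \<Longrightarrow> even (card (strand_arc s \<inter> flat_points D)) \<longleftrightarrow>
        even (card (strand_arc s \<inter> flat_points D'))"
  using assms unfolding reidemeister_move_def
proof
  assume "elementary_move B D D'"
  then show ?thesis using that by (rule elementary_move_strands)
next
  assume "elementary_move B D' D"
  then show ?thesis using that local_change_sym by (metis elementary_move_strands)
qed

text \<open>The first conjunct, existence and uniqueness of transport, justifies speaking of the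
  induced 2-colouring. The second is about pairs of coloured diagrams related by this
  transport.\<close>

theorem proposition2p11:
  shows "(\<forall>B D D' C. reidemeister_move B D D' \<and> two_colouring D C \<longrightarrow>
            (\<exists>!C'. coloured_move B (D, C) (D', C'))) \<and>
         is_strong_parity coloured_move (\<lambda>(D, C). colour_parity D C)"
proof (intro conjI allI impI)
  fix B D D' C
  assume *: "reidemeister_move B D D' \<and> two_colouring D C"
  then obtain S where S: "local_change B S D D'"
    "\<And>s. s \<in> set S \<Longrightarrow> even (card (strand_arc s \<inter> flat_points D)) \<longleftrightarrow>
        even (card (strand_arc s \<inter> flat_points D'))"
    by (auto elim: reidemeister_move_strands)
  interpret local_move B S D D' by unfold_locales (rule S)
  obtain C' where "two_colouring D' C'" "agree_outside B (D, C) (D', C')"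
    using transport_exists[of C] S(2) * by blast
  with * show "\<exists>!C'. coloured_move B (D, C) (D', C')"
    using transport_unique[of C] unfolding coloured_move_def by auto
next
  have move: "reidemeister_move B D D'" "two_colouring D C" "two_colouring D' C'"
      "agree_outside B (D, C) (D', C')"
    if "coloured_move B (D, C) (D', C')" for B D C D' C'
    using that by (simp_all add: coloured_move_def)
  \<comment> \<open>A persisting crossing either lies off the disc or is the classical crossing of a
    mixed move.\<close>
  have persists: "colour_parity D C c = colour_parity D' C' d"
    if m: "coloured_move B (D, C) (D', C')" and p: "persists B D D' c d" for B D C D' C' c d
  proof -
    obtain S where "local_change B S D D'"
      using move(1)[OF m] by (rule reidemeister_move_strands)
    then show ?thesis
      using p colour_parity_outside[OF _ move(2-4)[OF m]] colour_parity_mixed[OF _ move(2-4)[OF m]]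
      unfolding persists_def by blast
  qed
  have r1: "colour_parity D C c = 0"
    if "coloured_move B (D, C) (D', C')" "reidemeister1 B D D' c" for B D C D' C' c
    using that colour_parity_kink move(2)
    unfolding reidemeister1_def kink_def by blast
  have r2: "colour_parity D C c1 = colour_parity D C c2"
    if "coloured_move B (D, C) (D', C')" "reidemeister2 B D D' c1 c2" for B D C D' C' c1 c2
    using that colour_parity_bigon move(2)
    unfolding reidemeister2_def by blast
  have r3: "card {c \<in> {c1, c2, c3}. colour_parity D C c = 1} \<in> {3, 0, 2}"
      "\<not> (colour_parity D C c1 = 1 \<and> colour_parity D C c2 = 1 \<and> colour_parity D C c3 = 1)"
      "colour_parity D C c1 = colour_parity D' C' d1"
      "colour_parity D C c2 = colour_parity D' C' d2"
      "colour_parity D C c3 = colour_parity D' C' d3"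
    if m: "coloured_move B (D, C) (D', C')" and r: "reidemeister3 B D D' c1 c2 c3 d1 d2 d3"
    for B D C D' C' c1 c2 c3 d1 d2 d3
  proof -
    obtain s1 s2 s3 where t: "triangle_move B D D' s1 s2 s3 c1 c2 c3 d1 d2 d3"
      "{c1, c2, c3} \<subseteq> classical D" "{d1, d2, d3} \<subseteq> classical D'"
      using r unfolding reidemeister3_def by blast
    note par = colour_parity_triangle[OF t move(2-4)[OF m]]
    \<comment> \<open>For bits, being different means that exactly one of them is 1; this is the
      form required for the count of odd crossings.\<close>
    have "colour_parity D C c3 = 1 \<longleftrightarrow>
        (colour_parity D C c1 = 1) \<noteq> (colour_parity D C c2 = 1)"
      unfolding par(4) by (metis bit_not_one_iff)
    from even_card_filter_three[where P = "\<lambda>c. colour_parity D C c = 1", OF par(1-3) this]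
    show "card {c \<in> {c1, c2, c3}. colour_parity D C c = 1} \<in> {3, 0, 2}"
      "\<not> (colour_parity D C c1 = 1 \<and> colour_parity D C c2 = 1 \<and> colour_parity D C c3 = 1)"
      by blast+
    show "colour_parity D C c1 = colour_parity D' C' d1"
      "colour_parity D C c2 = colour_parity D' C' d2"
      "colour_parity D C c3 = colour_parity D' C' d3"
      by (rule par)+
  qed
  show "is_strong_parity coloured_move (\<lambda>(D, C). colour_parity D C)"
    unfolding is_strong_parity_def is_parity_def split_paired_All split_paired_Ex fst_conv prod.case
  \<comment> \<open>Goals 1 to 3 are axioms (0) to (2), goals 4 to 7 are the parts of axiom (3), and
    goal 8 is strength.\<close>
  proof (intro conjI allI impI notI, goal_cases)
    case 1
    then show ?case using persists by blast
  next
    case 2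
    then show ?case using r1 by blast
  next
    case 3
    then show ?case using r2 by blast
  next
    case 4
    then show ?case using r3(1) by blast
  next
    case 5
    then show ?case using r3(3) by blast
  next
    case 6
    then show ?case using r3(4) by blast
  next
    case 7
    then show ?case using r3(5) by blast
  next
    case 8
    then show ?case using r3(2) by blast
  qed
qed

end
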